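(* Let $(a_n)_{n\ge0}$ be the sequence, listed in increasing order, of the non-negative integers $m$ such that $240m+121$ is a perfect square. Then $$\sum_{n=0}^\infty(-1)^{\lfloor (n+2)/4\rfloor}q^{a_n}=\frac{(q^3,q^5,q^8;q^8)_\infty\,(q^2,q^{14};q^{16})_\infty}{(q,q^4;q^5)_\infty}.$$
   Context: Here $q$ is a complex number with $|q|<1$ (equivalently, the identity may be read as an identity of formal power series in $q$). For a complex number $a$, $(a;q)_\infty:=\prod_{i=0}^\infty(1-aq^i)$, and $(a_1,a_2,\dots,a_m;q)_\infty:=\prod_{j=1}^m(a_j;q)_\infty$. $\lfloor x\rfloor$ is the floor function. *)

theory Defs
  imports "HOL-Analysis.Infinite_Products" "HOL-Library.Infinite_Set"
begin

definition qpoch_inf :: "complex \<Rightarrow> complex \<Rightarrow> complex" where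
  "qpoch_inf a q = (\<Prod>i. 1 - a * q ^ i)"

definition qpochs_inf :: "complex list \<Rightarrow> complex \<Rightarrow> complex" where
  "qpochs_inf as q = (\<Prod>a\<leftarrow>as. qpoch_inf a q)"

definition sq_index_set :: "nat set" where
  "sq_index_set = {m. \<exists>k. 240 * m + 121 = k ^ 2}"

definition sq_index :: "nat \<Rightarrow> nat" where
  "sq_index n = enumerate sq_index_set n"

text \<open>The library functions \<^const>\<open>prodinf\<close> and \<^const>\<open>enumerate\<close> are total; the next two facts
  show that they are used here only where they have their intended meaning.\<close>

lemma qpoch_inf_has_prod:
  assumes "norm q < 1"
  shows "(\<lambda>i. 1 - a * q ^ i) has_prod qpoch_inf a q"
proof -
  have "summable (\<lambda>i. norm a * norm q ^ i)"
    using assms by (intro summable_mult summable_geometric) auto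
  then have "summable (\<lambda>i. norm ((1 - a * q ^ i) - 1))"
    by (simp add: norm_mult norm_power)
  then have "convergent_prod (\<lambda>i. 1 - a * q ^ i)"
    by (intro abs_convergent_prod_imp_convergent_prod summable_imp_abs_convergent_prod)
  then show ?thesis
    unfolding qpoch_inf_def by (rule convergent_prod_has_prod)
qed

lemma infinite_sq_index_set: "infinite sq_index_set"
proof -
  have "240 * (60 * j ^ 2 + 11 * (j::nat)) + 121 = (120 * j + 11) ^ 2" for j
    by (simp add: power2_eq_square algebra_simps)
  then have "60 * j ^ 2 + 11 * j \<in> sq_index_set" for j :: nat
    unfolding sq_index_set_def by blast
  then have "range (\<lambda>j::nat. 60 * j ^ 2 + 11 * j) \<subseteq> sq_index_set" by blast
  moreover have "strict_mono (\<lambda>j::nat. 60 * j ^ 2 + 11 * j)"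
    by (rule strict_monoI) (simp add: add_le_less_mono power_mono)
  then have "infinite (range (\<lambda>j::nat. 60 * j ^ 2 + 11 * j))"
    using range_inj_infinite strict_mono_imp_inj_on by blast
  ultimately show ?thesis using finite_subset by blast
qed

end

theory Submission
  imports Defs "HOL-Analysis.Infinite_Sum" "HOL-Analysis.Complex_Transcendental" "HOL-Library.Nat_Bijection"
begin

text \<open>
  Put \<open>q = x\<^sup>2\<^sup>4\<^sup>0\<close>. Up to a power of \<open>x\<close>, the left-hand side is a theta series
  \<open>T\<^sub>1 = \<Sum> c(k) x\<^bsup>k\<^sup>2\<^esup>\<close> whose weight is odd modulo 5 and supported on \<open>\<plusminus>1\<close>; let \<open>T\<^sub>2\<close> be its companion
  supported on \<open>\<plusminus>2\<close>, and let \<open>D\<^sub>1, D\<^sub>2\<close> be the theta numerators of the Rogers-Ramanujan functions \<open>G, H\<close>.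
  A reflection of the lattice \<open>k\<^sup>2 + 6m\<^sup>2\<close> with denominator 5 gives \<open>T\<^sub>1 D\<^sub>2 = T\<^sub>2 D\<^sub>1\<close>. Pairing \<open>(T\<^sub>1, T\<^sub>2)\<close>
  and \<open>(D\<^sub>1, D\<^sub>2)\<close> with \<open>(D\<^sub>1, D\<^sub>2)(q\<^sup>6)\<close> yields, again by lattice rotations, products of two theta
  series: \<open>N Y\<close> in the first case, where \<open>N\<close> is the numerator of the right-hand side and
  \<open>Y = (q, q\<^sup>5, q\<^sup>6; q\<^sup>6)\<^sub>\<infinity>\<close>, and \<open>\<phi>(-q) \<psi>(q\<^sup>3) = (q; q)\<^sub>\<infinity> Y\<close> in the second, which is Ramanujan's identity for
  \<open>G(q\<^sup>6)H(q) - qG(q)H(q\<^sup>6)\<close>. Eliminating \<open>T\<^sub>2\<close> and \<open>D\<^sub>2\<close> gives \<open>T\<^sub>1 (q; q)\<^sub>\<infinity> = N D\<^sub>1\<close>, and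
  \<open>D\<^sub>1 = (q; q)\<^sub>\<infinity> / (q, q\<^sup>4; q\<^sup>5)\<^sub>\<infinity>\<close>. The theta series become products by the Jacobi triple product and
  one case of the quintuple product identity.
\<close>

subsection \<open>Infinite \<open>q\<close>-Pochhammer symbols\<close>

lemma qpoch_inf_tendsto:
  assumes "norm q < 1"
  shows "(\<lambda>n. \<Prod>i<n. 1 - a * q ^ i) \<longlonglongrightarrow> qpoch_inf a q"
  using has_prod_imp_tendsto'[OF qpoch_inf_has_prod[OF assms]] .

text \<open>A convergent infinite product vanishes only through a zero factor, and |a q^i| < 1
  excludes one.\<close>

lemma qpoch_inf_nonzero:
  assumes "norm q < 1" "norm a < 1"
  shows "qpoch_inf a q \<noteq> 0"
proof
  assume "qpoch_inf a q = 0"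
  with qpoch_inf_has_prod[OF assms(1), of a] have "(\<lambda>i. 1 - a * q ^ i) has_prod 0"
    by simp
  then obtain i where "1 - a * q ^ i = 0"
    using has_prod_0D by force
  hence "norm (a * q ^ i) = 1"
    by (metis eq_iff_diff_eq_0 norm_one)
  moreover have "norm (a * q ^ i) \<le> norm a * 1"
    unfolding norm_mult norm_power using assms by (intro mult_left_mono power_le_one) auto
  ultimately show False using assms by simp
qed

text \<open>The factors are sorted by the residue of the exponent modulo \<open>m\<close>: a partial
  product of length \<open>n * m\<close> splits into \<open>m\<close> partial products of length
  \<open>n\<close>, and both sides pass to the limit.\<close>

lemma qpoch_inf_split:
  assumes "norm q < 1" "m > 0"
  shows "qpoch_inf a q = (\<Prod>r<m. qpoch_inf (a * q ^ r) (q ^ m))"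
proof -
  have nq: "norm (q ^ m) < 1"
    using assms by (simp add: norm_power power_less_one_iff)
  have "(\<lambda>n. \<Prod>r<m. \<Prod>j<n. 1 - (a * q ^ r) * (q ^ m) ^ j) \<longlonglongrightarrow> (\<Prod>r<m. qpoch_inf (a * q ^ r) (q ^ m))"
    by (intro tendsto_prod qpoch_inf_tendsto nq)
  moreover have "(\<Prod>r<m. \<Prod>j<n. 1 - (a * q ^ r) * (q ^ m) ^ j) = (\<Prod>i<n*m. 1 - a * q ^ i)" for n
  proof -
    have "(\<Prod>i<n*m. 1 - a * q ^ i) = (\<Prod>j<n. \<Prod>i\<in>{j*m..<j*m+m}. 1 - a * q ^ i)"
      by (rule prod.nat_group[symmetric])
    also have "\<dots> = (\<Prod>j<n. \<Prod>r<m. 1 - (a * q ^ r) * (q ^ m) ^ j)"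
    proof (rule prod.cong[OF refl])
      fix j
      show "(\<Prod>i\<in>{j*m..<j*m+m}. 1 - a * q ^ i) = (\<Prod>r<m. 1 - (a * q ^ r) * (q ^ m) ^ j)"
        by (rule prod.reindex_bij_witness[of _ "\<lambda>r. r + j*m" "\<lambda>i. i - j*m"])
           (auto simp flip: power_add power_mult simp: mult.assoc mult.commute[of j])
    qed
    also have "\<dots> = (\<Prod>r<m. \<Prod>j<n. 1 - (a * q ^ r) * (q ^ m) ^ j)"
      by (rule prod.swap)
    finally show ?thesis by simp
  qed
  moreover have "(\<lambda>n. \<Prod>i<n*m. 1 - a * q ^ i) \<longlonglongrightarrow> qpoch_inf a q"
    using LIMSEQ_subseq_LIMSEQ[OF qpoch_inf_tendsto[OF assms(1), of a], of "\<lambda>n. n * m"] assms(2)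
    by (simp add: strict_mono_def o_def)
  ultimately show ?thesis
    using LIMSEQ_unique by auto
qed

lemma qpoch_inf_mult_uminus:
  assumes "norm q < 1"
  shows "qpoch_inf a q * qpoch_inf (- a) q = qpoch_inf (a\<^sup>2) (q\<^sup>2)"
proof -
  have "norm (q\<^sup>2) < 1"
    using assms by (simp add: norm_power power_less_one_iff)
  from qpoch_inf_tendsto[OF this, of "a\<^sup>2"]
  have "(\<lambda>n. (\<Prod>i<n. 1 - a * q ^ i) * (\<Prod>i<n. 1 - (-a) * q ^ i)) \<longlonglongrightarrow> qpoch_inf (a\<^sup>2) (q\<^sup>2)"
    by (simp add: prod.distrib[symmetric] power2_eq_square algebra_simps power_mult_distrib)
  moreover have "(\<lambda>n. (\<Prod>i<n. 1 - a * q ^ i) * (\<Prod>i<n. 1 - (-a) * q ^ i)) \<longlonglongrightarrow> 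
      qpoch_inf a q * qpoch_inf (- a) q"
    by (intro tendsto_mult qpoch_inf_tendsto assms)
  ultimately show ?thesis using LIMSEQ_unique by blast
qed

subsection \<open>The Jacobi triple product\<close>

lemma summable_on_int:
  fixes f :: "int \<Rightarrow> real"
  assumes "summable (\<lambda>n. f (int n))" "summable (\<lambda>n. f (- int n))" "\<And>k. f k \<ge> 0"
  shows "f summable_on UNIV"
proof -
  have "f summable_on range int"
    using assms by (subst summable_on_reindex) (auto simp: o_def summable_on_UNIV_nonneg_real_iff)
  moreover have "f summable_on range (\<lambda>n. - int n)"
    using assms by (subst summable_on_reindex) (auto simp: o_def inj_def summable_on_UNIV_nonneg_real_iff)
  ultimately have "f summable_on (range int \<union> range (\<lambda>n. - int n))"
    by (rule summable_on_union)
  moreover have "range int \<union> range (\<lambda>n. - int n) = UNIV"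
    by (auto simp: image_iff) (metis int_cases2)
  ultimately show ?thesis by simp
qed

text \<open>Tannery's theorem for series over \<open>nat\<close>, transported along the bijection
  \<open>int_decode\<close>; it exchanges limit and sum in the triple product.\<close>

lemma tendsto_infsum_int_dominated:
  fixes f :: "nat \<Rightarrow> int \<Rightarrow> complex"
  assumes lim: "\<And>k. (\<lambda>n. f n k) \<longlonglongrightarrow> g k"
    and bound: "\<And>n k. norm (f n k) \<le> M k" and "M summable_on UNIV"
  shows "g summable_on UNIV" "(\<lambda>n. \<Sum>\<^sub>\<infinity>k. f n k) \<longlonglongrightarrow> (\<Sum>\<^sub>\<infinity>k. g k)"
proof -
  have bij: "bij int_decode"
    by (rule bij_int_decode)
  have M: "(\<lambda>i. M (int_decode i)) summable_on UNIV"
    using assms(3) summable_on_reindex_bij_betw[OF bij] by blast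
  have norm_sum: "h summable_on UNIV" "infsum h UNIV = (\<Sum>i. h (int_decode i))"
    if h: "\<And>k. norm (h k) \<le> M k" for h :: "int \<Rightarrow> complex"
  proof -
    have "(\<lambda>k. norm (h k)) summable_on UNIV"
      by (rule summable_on_comparison_test[OF assms(3)]) (use h in auto)
    thus s: "h summable_on UNIV"
      by (rule abs_summable_summable)
    hence "(\<lambda>i. h (int_decode i)) summable_on UNIV"
      using summable_on_reindex_bij_betw[OF bij] by blast
    hence "(\<lambda>i. h (int_decode i)) sums (\<Sum>\<^sub>\<infinity>i. h (int_decode i))"
      by (intro has_sum_imp_sums) simp
    thus "infsum h UNIV = (\<Sum>i. h (int_decode i))"
      using infsum_reindex_bij_betw[OF bij, of h] by (simp add: sums_iff)
  qed
  have g: "norm (g k) \<le> M k" for k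
    by (rule Lim_norm_ubound[OF _ lim]) (auto simp: bound)
  show "g summable_on UNIV"
    by (rule norm_sum[OF g])
  have "(\<lambda>n. \<Sum>i. f n (int_decode i)) \<longlonglongrightarrow> (\<Sum>i. g (int_decode i))"
    using tannerys_theorem[of "\<lambda>i n. f n (int_decode i)" "\<lambda>i. g (int_decode i)" sequentially "\<lambda>i. M (int_decode i)"]
      lim bound M by (simp add: summable_on_imp_summable case_prod_unfold)
  thus "(\<lambda>n. \<Sum>\<^sub>\<infinity>k. f n k) \<longlonglongrightarrow> (\<Sum>\<^sub>\<infinity>k. g k)"
    by (simp add: norm_sum(2)[OF g] norm_sum(2)[OF bound])
qed

section \<open>A finite form of the triple product\<close>

definition qfact :: "complex \<Rightarrow> nat \<Rightarrow> complex" where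
  "qfact q n = (\<Prod>i<n. 1 - q * q ^ i)"

text \<open>Extending the reciprocal by 0 to negative indices keeps its recurrence valid everywhere, so that
  the finite triple product can be summed over all integers.\<close>

definition rqfact :: "complex \<Rightarrow> int \<Rightarrow> complex" where
  "rqfact q m = (if m < 0 then 0 else inverse (qfact q (nat m)))"

lemma qfact_nonzero:
  assumes "norm q < 1"
  shows "qfact q n \<noteq> 0"
proof -
  have "1 - q * q ^ i \<noteq> 0" for i
  proof
    assume "1 - q * q ^ i = 0"
    hence "q ^ Suc i = 1" by simp
    hence "norm q ^ Suc i = 1" by (metis norm_one norm_power)
    thus False using assms power_Suc_less_one[of "norm q" i]
      by (metis norm_ge_zero less_le power_eq_0_iff power_0_Suc zero_neq_one less_irrefl)
  qed
  thus ?thesis by (simp add: qfact_def)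
qed

lemma rqfact_rec:
  assumes "norm q < 1"
  shows "rqfact q (m - 1) = (1 - q powi m) * rqfact q m"
proof (cases "m \<le> 0")
  case True
  \<comment> \<open>At \<open>m = 0\<close> the left side is 0 by convention and the factor
    \<open>1 - q powi 0\<close> vanishes.\<close>
  thus ?thesis by (cases "m = 0") (auto simp: rqfact_def)
next
  case False
  then obtain n where m: "m = int (Suc n)"
    by (metis not_le zero_less_imp_eq_int gr0_implies_Suc)
  have "qfact q (Suc n) = (1 - q ^ Suc n) * qfact q n"
    by (simp add: qfact_def)
  moreover have "qfact q (Suc n) \<noteq> 0" "qfact q n \<noteq> 0"
    using qfact_nonzero[OF assms] by auto
  moreover have "q powi m = q ^ Suc n"
    unfolding m by (rule power_int_of_nat)
  moreover have "nat m = Suc n" "nat (m - 1) = n" "\<not> m - 1 < 0"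
    using m by auto
  ultimately show ?thesis
    using False by (simp add: rqfact_def field_simps)
qed

text \<open>With \<open>qfact q n\<close> the finite symbol (q;q)_n, the last factor is the Gaussian
  binomial coefficient of 2n over n + k; the whole is the coefficient of z^k in (z;q)_n
  (q/z;q)_n.\<close>

definition triple_coeff :: "complex \<Rightarrow> nat \<Rightarrow> int \<Rightarrow> complex" where
  "triple_coeff q n k =
     (-1) powi k * q powi (k * (k - 1) div 2) * (qfact q (2 * n) * rqfact q (int n + k) * rqfact q (int n - k))"

text \<open>This is the coefficient form of multiplication by (1 - z q^n)(1 - q^(n+1)/z). Once every
  term is expressed through \<open>u\<close>, \<open>v\<close> and the reciprocals \<open>A\<close>,
  \<open>B\<close> of highest index, a polynomial identity remains.\<close>

lemma triple_coeff_rec: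
  assumes "norm q < 1" "q \<noteq> 0"
  shows "triple_coeff q (Suc n) k = (1 + q ^ (2*n+1)) * triple_coeff q n k
           - q ^ n * triple_coeff q n (k - 1) - q ^ (n + 1) * triple_coeff q n (k + 1)"
proof -
  define u v where "u = q powi (int n + k)" and "v = q powi (int n - k)"
  define A B where "A = rqfact q (int n + k + 1)" and "B = rqfact q (int n - k + 1)"
  define E where "E = q powi (k * (k - 1) div 2)"
  have uv: "u * v = q ^ (2*n)"
    unfolding u_def v_def power_int_add[symmetric, OF disjI1[OF assms(2)]]
    by (simp flip: power_int_of_nat)
  have r: "rqfact q (int n + k) = (1 - u * q) * A" "rqfact q (int n - k) = (1 - v * q) * B"
    using rqfact_rec[OF assms(1), of "int n + k + 1"] rqfact_rec[OF assms(1), of "int n - k + 1"] assms(2)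
    by (simp_all add: A_def B_def u_def v_def power_int_add)
  have r': "rqfact q (int n + k - 1) = (1 - u) * ((1 - u * q) * A)"
           "rqfact q (int n - k - 1) = (1 - v) * ((1 - v * q) * B)"
    using rqfact_rec[OF assms(1), of "int n + k"] rqfact_rec[OF assms(1), of "int n - k"] r
    by (simp_all add: u_def v_def)
  have k1: "(k - 1) * (k - 1 - 1) div 2 + (k - 1) = k * (k - 1) div 2" for k :: int
  proof -
    have "k * (k - 1) = (k - 1) * (k - 1 - 1) + (k - 1) * 2"
      by (simp add: algebra_simps)
    thus ?thesis by simp
  qed
  have e1: "q ^ n * q powi ((k - 1) * (k - 1 - 1) div 2) = v * q * E"
  proof -
    have "E = q powi ((k - 1) * (k - 1 - 1) div 2) * q powi (k - 1)"
      unfolding E_def using assms(2) k1[of k] by (metis power_int_add)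
    moreover have "v * q * q powi (k - 1) = q ^ n"
      using assms(2) by (simp add: v_def power_int_add power_int_diff)
    ultimately show ?thesis by (metis mult.assoc mult.commute)
  qed
  have e2: "q ^ (n + 1) * q powi ((k + 1) * (k + 1 - 1) div 2) = u * q * E"
  proof -
    have "q powi ((k + 1) * (k + 1 - 1) div 2) = E * q powi k"
      unfolding E_def using assms(2) k1[of "k + 1"] power_int_add[of q "k * (k - 1) div 2" k] by simp
    thus ?thesis
      using assms(2) by (simp add: u_def power_int_add)
  qed
  have f: "qfact q (2 * Suc n) = (1 - u * v * q) * (1 - u * v * q\<^sup>2) * qfact q (2 * n)"
    unfolding uv by (simp add: qfact_def power2_eq_square mult_ac)
  define s :: complex where "s = (-1) powi k"
  define F where "F = qfact q (2 * n)"
  have s: "(-1) powi (k - 1) = - s" "(-1) powi (k + 1) = - s"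
    by (simp_all add: s_def power_int_add power_int_diff)
  have t0: "triple_coeff q n k = s * E * (F * ((1 - u * q) * A) * ((1 - v * q) * B))"
    by (simp add: triple_coeff_def s_def E_def F_def r)
  have t1: "q ^ n * triple_coeff q n (k - 1) = - s * (v * q * E) * (F * ((1 - u) * ((1 - u * q) * A)) * B)"
  proof -
    have "int n + (k - 1) = int n + k - 1" "int n - (k - 1) = int n - k + 1" by auto
    hence "q ^ n * triple_coeff q n (k - 1) =
       - s * (q ^ n * q powi ((k - 1) * (k - 1 - 1) div 2)) * (F * rqfact q (int n + k - 1) * B)"
      unfolding triple_coeff_def s B_def F_def by (simp only: mult_ac)
    thus ?thesis unfolding e1 r' .
  qed
  have t2: "q ^ (n + 1) * triple_coeff q n (k + 1) = - s * (u * q * E) * (F * A * ((1 - v) * ((1 - v * q) * B)))"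
  proof -
    have "int n + (k + 1) = int n + k + 1" "int n - (k + 1) = int n - k - 1" by auto
    hence "q ^ (n + 1) * triple_coeff q n (k + 1) =
       - s * (q ^ (n + 1) * q powi ((k + 1) * (k + 1 - 1) div 2)) * (F * A * rqfact q (int n - k - 1))"
      unfolding triple_coeff_def s A_def F_def by (simp only: mult_ac)
    thus ?thesis unfolding e2 r' .
  qed
  have t3: "triple_coeff q (Suc n) k = s * E * ((1 - u * v * q) * (1 - u * v * q\<^sup>2) * F * A * B)"
  proof -
    have "int (Suc n) + k = int n + k + 1" "int (Suc n) - k = int n - k + 1" by auto
    thus ?thesis unfolding triple_coeff_def f s_def E_def F_def A_def B_def by (simp only: mult.assoc)
  qed
  have h: "q ^ (2 * n + 1) = u * v * q" by (simp add: uv)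
  show ?thesis
    unfolding t0 t1 t2 t3 h by (simp add: algebra_simps power2_eq_square)
qed

lemma finite_triple_product:
  assumes "norm q < 1" "q \<noteq> 0" "z \<noteq> 0"
  shows "((\<lambda>k. triple_coeff q n k * z powi k) has_sum
           ((\<Prod>i<n. 1 - z * q ^ i) * (\<Prod>i<n. 1 - (q / z) * q ^ i))) UNIV"
proof (induction n)
  case 0
  let ?f = "\<lambda>k. triple_coeff q 0 k * z powi k"
  have "?f k = 0" if "k \<noteq> 0" for k
    using that by (auto simp: triple_coeff_def rqfact_def)
  hence "(?f has_sum (\<Sum>k\<in>{0}. ?f k)) UNIV \<longleftrightarrow> (?f has_sum (\<Sum>k\<in>{0}. ?f k)) {0}"
    by (intro has_sum_cong_neutral) auto
  hence "(?f has_sum (\<Sum>k\<in>{0}. ?f k)) UNIV"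
    using has_sum_finite[of "{0}" ?f] by blast
  thus ?case by (simp add: triple_coeff_def rqfact_def qfact_def)
next
  case (Suc n)
  let ?f = "\<lambda>k. triple_coeff q n k * z powi k"
  define S where "S = (\<Prod>i<n. 1 - z * q ^ i) * (\<Prod>i<n. 1 - (q / z) * q ^ i)"
  have S: "(?f has_sum S) UNIV" using Suc.IH by (simp add: S_def)
  have S1: "((\<lambda>k. ?f (k - 1)) has_sum S) UNIV"
    using S by (subst has_sum_reindex_bij_witness[where i = "\<lambda>k. k + 1" and j = "\<lambda>k. k - 1" and T = UNIV and h = ?f]) auto
  have S2: "((\<lambda>k. ?f (k + 1)) has_sum S) UNIV"
    using S by (subst has_sum_reindex_bij_witness[where i = "\<lambda>k. k - 1" and j = "\<lambda>k. k + 1" and T = UNIV and h = ?f]) auto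
  have "((\<lambda>k. (1 + q ^ (2*n+1)) * ?f k + (- z * q ^ n) * ?f (k - 1) + (- (q ^ (n + 1)) / z) * ?f (k + 1))
      has_sum ((1 + q ^ (2*n+1)) * S + (- z * q ^ n) * S + (- (q ^ (n + 1)) / z) * S)) UNIV"
    by (intro has_sum_add has_sum_cmult_right S S1 S2)
  moreover have "(1 + q ^ (2*n+1)) * ?f k + (- z * q ^ n) * ?f (k - 1) + (- (q ^ (n + 1)) / z) * ?f (k + 1)
      = triple_coeff q (Suc n) k * z powi k" for k
    unfolding triple_coeff_rec[OF assms(1,2)] using assms(3)
    by (simp add: power_int_add power_int_diff field_simps)
  moreover have "(1 + q ^ (2*n+1)) * S + (- z * q ^ n) * S + (- (q ^ (n + 1)) / z) * S
      = (\<Prod>i<Suc n. 1 - z * q ^ i) * (\<Prod>i<Suc n. 1 - (q / z) * q ^ i)"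
  proof -
    have "(1 + q ^ (2*n+1)) + (- z * q ^ n) + (- (q ^ (n + 1)) / z) = (1 - z * q ^ n) * (1 - (q / z) * q ^ n)"
      using assms(3) by (simp add: field_simps mult_2_right power_add)
    hence "(1 + q ^ (2*n+1)) * S + (- z * q ^ n) * S + (- (q ^ (n + 1)) / z) * S =
        (1 - z * q ^ n) * (1 - (q / z) * q ^ n) * S"
      by (metis distrib_right)
    thus ?thesis by (simp add: S_def)
  qed
  ultimately show ?case by simp
qed

section \<open>Gaussian majorants and the limit of the finite form\<close>

lemma summable_gaussian:
  fixes a r :: real
  assumes "0 < r" "r < 1" "a > 0"
  shows "summable (\<lambda>n. a ^ n * r ^ (n * (n - 1) div 2))"
proof -
  have "(\<lambda>n. a * r ^ n) \<longlonglongrightarrow> a * 0"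
    using assms by (intro tendsto_intros LIMSEQ_power_zero) auto
  hence "eventually (\<lambda>n. a * r ^ n < 1/2) sequentially"
    by (rule order_tendstoD) auto
  then obtain N where N: "\<And>n. n \<ge> N \<Longrightarrow> a * r ^ n < 1/2"
    by (auto simp: eventually_at_top_linorder)
  show ?thesis
  proof (rule summable_ratio_test[of "1/2" N])
    fix n assume "n \<ge> N"
    have "Suc n * (Suc n - 1) div 2 = n * (n - 1) div 2 + n"
    proof -
      have "Suc n * (Suc n - 1) = n * (n - 1) + n * 2"
        by (cases n) auto
      thus ?thesis by simp
    qed
    hence "a ^ Suc n * r ^ (Suc n * (Suc n - 1) div 2) = (a * r ^ n) * (a ^ n * r ^ (n * (n - 1) div 2))"
      by (simp add: power_add)
    also have "\<dots> \<le> 1/2 * (a ^ n * r ^ (n * (n - 1) div 2))"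
      using assms N[OF \<open>n \<ge> N\<close>] by (intro mult_right_mono) auto
    finally show "norm (a ^ Suc n * r ^ (Suc n * (Suc n - 1) div 2)) \<le> 1/2 * norm (a ^ n * r ^ (n * (n - 1) div 2))"
      using assms by simp
  qed auto
qed

lemma summable_on_gaussian_int:
  fixes a r :: real
  assumes "0 < r" "r < 1" "a > 0"
  shows "(\<lambda>k::int. a powi k * r powi (k * (k - 1) div 2)) summable_on UNIV"
proof (rule summable_on_int)
  have "a powi int n * r powi (int n * (int n - 1) div 2) = a ^ n * r ^ (n * (n - 1) div 2)" for n
  proof -
    have "int n * (int n - 1) div 2 = int (n * (n - 1) div 2)"
      by (cases n) (auto simp: zdiv_int algebra_simps)
    thus ?thesis by (simp add: power_int_of_nat)
  qed
  thus "summable (\<lambda>n. a powi int n * r powi (int n * (int n - 1) div 2))"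
    by (simp only: summable_gaussian[OF assms])
  \<comment> \<open>At k = -n the triangular exponent is n(n-1)/2 + n, so the negative half is the
    same series with \<open>r / a\<close> in place of \<open>a\<close>.\<close>
  have "a powi (- int n) * r powi ((- int n) * (- int n - 1) div 2) = (r / a) ^ n * r ^ (n * (n - 1) div 2)" for n
  proof -
    have "(- int n) * (- int n - 1) = int (n * (n - 1)) + int n * 2"
      by (cases n) (auto simp: algebra_simps)
    hence "(- int n) * (- int n - 1) div 2 = int (n * (n - 1) div 2 + n)"
      by (simp add: zdiv_int)
    thus ?thesis
      by (simp add: power_int_minus power_int_of_nat power_add field_simps del: of_nat_add)
  qed
  thus "summable (\<lambda>n. a powi (- int n) * r powi ((- int n) * (- int n - 1) div 2))"
    using summable_gaussian[of r "r / a"] assms by (simp only:) simp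
qed (use assms in auto)

text \<open>Limit of \<open>finite_triple_product\<close>: the binomial factor tends to 1/P and is
  bounded uniformly in \<open>n\<close> and \<open>k\<close>, so the Gaussian majorant permits the
  termwise limit. Multiplication by \<open>P\<close> then clears the denominator.\<close>

theorem jacobi_triple_product:
  assumes "norm q < 1" "q \<noteq> 0" "z \<noteq> 0"
  shows "((\<lambda>k. (-1) powi k * q powi (k * (k - 1) div 2) * z powi k) has_sum
           (qpoch_inf z q * qpoch_inf (q / z) q * qpoch_inf q q)) UNIV"
proof -
  define P where "P = qpoch_inf q q"
  have P: "P \<noteq> 0"
    unfolding P_def using assms by (intro qpoch_inf_nonzero) auto
  have lq: "qfact q \<longlonglongrightarrow> P"
    unfolding qfact_def P_def by (rule qpoch_inf_tendsto[OF assms(1)])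
  have lr: "(\<lambda>n. inverse (qfact q n)) \<longlonglongrightarrow> inverse P"
    by (intro tendsto_inverse lq P)
  obtain C1 where C1: "\<And>n. norm (qfact q n) \<le> C1" "C1 > 0"
    using convergent_imp_Bseq[OF convergentI[OF lq]] unfolding Bseq_def by blast
  obtain C2 where C2: "\<And>n. norm (inverse (qfact q n)) \<le> C2" "C2 > 0"
    using convergent_imp_Bseq[OF convergentI[OF lr]] unfolding Bseq_def by blast
  have rq: "norm (rqfact q m) \<le> C2" for m
    using C2(1)[of "nat m"] C2(2) unfolding rqfact_def by auto
  have lrq: "(\<lambda>n. rqfact q (int n + k)) \<longlonglongrightarrow> inverse P" for k
  proof -
    \<comment> \<open>The shift by \<open>nat (-k)\<close> keeps the index non-negative, away from
      the default value 0 of \<open>rqfact\<close>.\<close>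
    have "eventually (\<lambda>n. rqfact q (int (n + nat (-k)) + k) = inverse (qfact q (n + nat (-k) + nat k - nat (-k)))) sequentially"
    proof (intro always_eventually allI)
      fix n
      have "nat (int (n + nat (-k)) + k) = n + nat (-k) + nat k - nat (-k)" "int (n + nat (-k)) + k \<ge> 0"
        by auto
      thus "rqfact q (int (n + nat (-k)) + k) = inverse (qfact q (n + nat (-k) + nat k - nat (-k)))"
        by (simp add: rqfact_def)
    qed
    moreover have "(\<lambda>n. inverse (qfact q (n + nat (-k) + nat k - nat (-k)))) \<longlonglongrightarrow> inverse P"
      using LIMSEQ_ignore_initial_segment[OF lr, of "nat k"] by (simp add: add.commute add.left_commute)
    ultimately have "(\<lambda>n. rqfact q (int (n + nat (-k)) + k)) \<longlonglongrightarrow> inverse P"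
      using tendsto_cong by fast
    thus ?thesis by (rule LIMSEQ_offset)
  qed
  let ?g = "\<lambda>k. (-1) powi k * q powi (k * (k - 1) div 2) * (P * inverse P * inverse P) * z powi k"
  let ?M = "\<lambda>k. (C1 * C2 * C2) * (norm z powi k * norm q powi (k * (k - 1) div 2))"
  have lim: "(\<lambda>n. triple_coeff q n k * z powi k) \<longlonglongrightarrow> ?g k" for k
  proof -
    have "(\<lambda>n. qfact q (2 * n)) \<longlonglongrightarrow> P"
      using LIMSEQ_subseq_LIMSEQ[OF lq, of "\<lambda>n. 2 * n"] by (simp add: strict_mono_def o_def)
    moreover have "(\<lambda>n. rqfact q (int n - k)) \<longlonglongrightarrow> inverse P"
      using lrq[of "- k"] by simp
    ultimately show ?thesis
      unfolding triple_coeff_def by (intro tendsto_intros lrq)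
  qed
  have bound: "norm (triple_coeff q n k * z powi k) \<le> ?M k" for n k
  proof -
    have "norm (qfact q (2 * n) * rqfact q (int n + k) * rqfact q (int n - k)) \<le> C1 * C2 * C2"
      unfolding norm_mult using C1 C2 rq by (intro mult_mono) auto
    hence "norm (qfact q (2 * n) * rqfact q (int n + k) * rqfact q (int n - k)) * (norm z powi k * norm q powi (k * (k - 1) div 2))
        \<le> ?M k"
      by (intro mult_right_mono) auto
    thus ?thesis
      by (simp add: triple_coeff_def norm_mult norm_power_int mult_ac)
  qed
  have sM: "?M summable_on UNIV"
    using assms by (intro summable_on_cmult_right summable_on_gaussian_int) auto
  note conv = tendsto_infsum_int_dominated[of "\<lambda>n k. triple_coeff q n k * z powi k" ?g ?M, OF lim bound sM]
  have "(\<lambda>n. (\<Prod>i<n. 1 - z * q ^ i) * (\<Prod>i<n. 1 - (q / z) * q ^ i)) \<longlonglongrightarrow> infsum ?g UNIV"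
    using conv(2) by (simp add: infsumI[OF finite_triple_product[OF assms]])
  moreover have "(\<lambda>n. (\<Prod>i<n. 1 - z * q ^ i) * (\<Prod>i<n. 1 - (q / z) * q ^ i)) \<longlonglongrightarrow> qpoch_inf z q * qpoch_inf (q / z) q"
    by (intro tendsto_mult qpoch_inf_tendsto assms)
  ultimately have "infsum ?g UNIV = qpoch_inf z q * qpoch_inf (q / z) q"
    using LIMSEQ_unique by blast
  with conv(1) have "(?g has_sum (qpoch_inf z q * qpoch_inf (q / z) q)) UNIV"
    using has_sum_infsum by fastforce
  from has_sum_cmult_right[OF this, of P] show ?thesis
    using P by (simp add: P_def mult_ac field_simps)
qed

subsection \<open>Theta series with bounded integer weights\<close>

text \<open>For \<open>t > 0\<close> the exponent is non-negative and \<open>nat\<close> is exact.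
  Integer weights let identities between them be checked residue by residue.\<close>

definition theta :: "(int \<Rightarrow> int) \<Rightarrow> int \<Rightarrow> complex \<Rightarrow> complex" where
  "theta c t x = (\<Sum>\<^sub>\<infinity>k. of_int (c k) * x ^ nat (t * k\<^sup>2))"

text \<open>The index set is a parameter so that a sum can be cut down to a congruence sublattice
  before a substitution.\<close>

definition theta2 :: "(int \<Rightarrow> int \<Rightarrow> int) \<Rightarrow> int \<Rightarrow> int \<Rightarrow> complex \<Rightarrow> (int \<times> int) set \<Rightarrow> complex" where
  "theta2 w t s x A = (\<Sum>\<^sub>\<infinity>(k,m)\<in>A. of_int (w k m) * x ^ nat (t * k\<^sup>2 + s * m\<^sup>2))"

lemma abs_le_square_int: "\<bar>k::int\<bar> \<le> k\<^sup>2"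
proof (cases "k = 0")
  case False
  hence "\<bar>k\<bar> * 1 \<le> \<bar>k\<bar> * \<bar>k\<bar>" by (intro mult_left_mono) auto
  thus ?thesis by (simp add: power2_eq_square)
qed auto

lemma summable_on_geometric_int:
  fixes r :: real
  assumes "0 \<le> r" "r < 1"
  shows "(\<lambda>k::int. r ^ nat \<bar>k\<bar>) summable_on UNIV"
  using assms by (intro summable_on_int) (auto simp: summable_geometric)

text \<open>Since |k| <= k^2, the geometric series in |k| is a majorant.\<close>

lemma theta_summable:
  fixes x :: complex
  assumes "norm x < 1" "t > 0" "\<And>k. \<bar>c k\<bar> \<le> 1"
  shows "(\<lambda>k. of_int (c k) * x ^ nat (t * k\<^sup>2)) abs_summable_on A"
proof (rule summable_on_subset_banach[of _ UNIV])
  show "(\<lambda>k. norm (of_int (c k) * x ^ nat (t * k\<^sup>2))) summable_on UNIV"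
  proof (rule summable_on_comparison_test[OF summable_on_geometric_int[of "norm x"]])
    fix k :: int
    have "1 * k\<^sup>2 \<le> t * k\<^sup>2" using assms(2) by (intro mult_right_mono) auto
    hence "nat \<bar>k\<bar> \<le> nat (t * k\<^sup>2)" using abs_le_square_int[of k] by linarith
    hence "norm x ^ nat (t * k\<^sup>2) \<le> norm x ^ nat \<bar>k\<bar>"
      using assms(1) by (intro power_decreasing) auto
    moreover have "\<bar>real_of_int (c k)\<bar> \<le> 1" using assms(3)[of k] by linarith
    ultimately have "\<bar>real_of_int (c k)\<bar> * norm x ^ nat (t * k\<^sup>2) \<le> 1 * norm x ^ nat \<bar>k\<bar>"
      by (intro mult_mono) auto
    thus "norm (of_int (c k) * x ^ nat (t * k\<^sup>2)) \<le> norm x ^ nat \<bar>k\<bar>"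
      by (simp add: norm_mult norm_power)
  qed (use assms in auto)
qed auto

lemma power_quadratic_form:
  fixes x :: complex
  assumes "t > 0" "s > 0"
  shows "x ^ nat (t * k\<^sup>2 + s * m\<^sup>2) = x ^ nat (t * k\<^sup>2) * x ^ nat (s * m\<^sup>2)"
  using assms by (simp add: nat_add_distrib power_add)

lemma theta2_summable:
  fixes x :: complex
  assumes "norm x < 1" "t > 0" "s > 0" "\<And>k m. \<bar>w k m\<bar> \<le> 1"
  shows "(\<lambda>(k,m). of_int (w k m) * x ^ nat (t * k\<^sup>2 + s * m\<^sup>2)) summable_on A"
proof (rule summable_on_subset_banach[of _ UNIV])
  let ?a = "\<lambda>k. x ^ nat (t * k\<^sup>2)" and ?b = "\<lambda>m. x ^ nat (s * m\<^sup>2)"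
  have a: "?a abs_summable_on UNIV" and b: "?b abs_summable_on UNIV"
    using theta_summable[of x t "\<lambda>_. 1" UNIV] theta_summable[of x s "\<lambda>_. 1" UNIV] assms by auto
  have "(\<lambda>(k,m). ?a k * ?b m) abs_summable_on UNIV \<times> UNIV"
    using a b by (subst abs_summable_on_Sigma_iff)
      (auto simp: norm_mult infsum_cmult_right' abs_mult intro!: summable_on_cmult_right summable_on_cmult_left infsum_nonneg)
  hence "(\<lambda>(k,m). of_int (w k m) * x ^ nat (t * k\<^sup>2 + s * m\<^sup>2)) abs_summable_on UNIV \<times> UNIV"
  proof (rule abs_summable_on_comparison_test)
    fix p :: "int \<times> int"
    obtain k m where p: "p = (k, m)" by (cases p)
    have "\<bar>real_of_int (w k m)\<bar> \<le> 1" using assms(4)[of k m] by linarith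
    hence "\<bar>real_of_int (w k m)\<bar> * norm (?a k * ?b m) \<le> 1 * norm (?a k * ?b m)"
      by (intro mult_right_mono) auto
    thus "norm (case p of (k,m) \<Rightarrow> of_int (w k m) * x ^ nat (t * k\<^sup>2 + s * m\<^sup>2))
        \<le> norm (case p of (k,m) \<Rightarrow> ?a k * ?b m)"
      using assms(2,3) by (simp add: p norm_mult power_quadratic_form)
  qed
  thus "(\<lambda>(k,m). of_int (w k m) * x ^ nat (t * k\<^sup>2 + s * m\<^sup>2)) summable_on UNIV"
    by (simp add: abs_summable_summable)
qed auto

lemma theta_mult:
  assumes "norm x < 1" "t > 0" "s > 0" "\<And>k. \<bar>c k\<bar> \<le> 1" "\<And>m. \<bar>d m\<bar> \<le> 1"
  shows "theta c t x * theta d s x = theta2 (\<lambda>k m. c k * d m) t s x UNIV"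
proof -
  have bd: "\<bar>c k * d m\<bar> \<le> 1" for k m
    using mult_mono[OF assms(4)[of k] assms(5)[of m]] by (simp add: abs_mult)
  have "theta2 (\<lambda>k m. c k * d m) t s x UNIV =
      (\<Sum>\<^sub>\<infinity>k. \<Sum>\<^sub>\<infinity>m. of_int (c k * d m) * x ^ nat (t * k\<^sup>2 + s * m\<^sup>2))"
    using infsum_Sigma'_banach[of "\<lambda>k m. of_int (c k * d m) * x ^ nat (t * k\<^sup>2 + s * m\<^sup>2)" UNIV "\<lambda>_. UNIV"]
      theta2_summable[of x t s "\<lambda>k m. c k * d m" UNIV] assms bd
    by (simp add: theta2_def)
  also have "\<dots> = (\<Sum>\<^sub>\<infinity>k. of_int (c k) * x ^ nat (t * k\<^sup>2) * theta d s x)"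
  proof (rule infsum_cong)
    fix k
    have "(\<Sum>\<^sub>\<infinity>m. of_int (c k * d m) * x ^ nat (t * k\<^sup>2 + s * m\<^sup>2)) =
        (\<Sum>\<^sub>\<infinity>m. (of_int (c k) * x ^ nat (t * k\<^sup>2)) * (of_int (d m) * x ^ nat (s * m\<^sup>2)))"
      by (simp add: power_quadratic_form assms mult_ac)
    thus "(\<Sum>\<^sub>\<infinity>m. of_int (c k * d m) * x ^ nat (t * k\<^sup>2 + s * m\<^sup>2)) = of_int (c k) * x ^ nat (t * k\<^sup>2) * theta d s x"
      by (simp add: theta_def infsum_cmult_right')
  qed
  also have "\<dots> = theta c t x * theta d s x"
    by (simp add: theta_def infsum_cmult_left')
  finally show ?thesis ..
qed

lemma theta2_Un:
  assumes "norm x < 1" "t > 0" "s > 0" "\<And>k m. \<bar>w k m\<bar> \<le> 1" "A \<inter> B = {}"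
  shows "theta2 w t s x (A \<union> B) = theta2 w t s x A + theta2 w t s x B"
  unfolding theta2_def using assms by (intro infsum_Un_disjoint theta2_summable) auto

lemma theta2_cong_neutral:
  assumes "\<And>k m. (k,m) \<in> A \<inter> B \<Longrightarrow> v k m = w k m"
    and "\<And>k m. (k,m) \<in> A - B \<Longrightarrow> v k m = 0" and "\<And>k m. (k,m) \<in> B - A \<Longrightarrow> w k m = 0"
  shows "theta2 v t s x A = theta2 w t s x B"
  unfolding theta2_def by (rule infsum_cong_neutral) (use assms in \<open>auto split: prod.splits\<close>)

lemma theta2_uminus: "theta2 (\<lambda>k m. - w k m) t s x A = - theta2 w t s x A"
  by (simp add: theta2_def infsum_uminus[symmetric] case_prod_unfold)

lemma theta2_diff:
  assumes "norm x < 1" "t > 0" "s > 0" "\<And>k m. \<bar>v k m\<bar> \<le> 1" "\<And>k m. \<bar>w k m\<bar> \<le> 1"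
  shows "theta2 (\<lambda>k m. v k m - w k m) t s x A = theta2 v t s x A - theta2 w t s x A"
proof -
  have "theta2 v t s x A + theta2 (\<lambda>k m. - w k m) t s x A = theta2 (\<lambda>k m. v k m - w k m) t s x A"
    unfolding theta2_def using theta2_summable[of x t s v A] theta2_summable[of x t s "\<lambda>k m. - w k m" A] assms
    by (subst infsum_add[symmetric]) (auto simp: case_prod_unfold algebra_simps)
  thus ?thesis by (simp add: theta2_uminus)
qed

text \<open>All lattice rotations below are instances. As \<open>i\<close> and \<open>j\<close> are
  inverse only between \<open>A\<close> and \<open>B\<close>, they may be written with
  \<open>div\<close>, which the congruences defining these sets make exact.\<close>

lemma theta2_reindex:
  assumes "\<And>k m. (k,m) \<in> A \<Longrightarrow> j (k,m) \<in> B \<and> i (j (k,m)) = (k,m)"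
    and "\<And>u v. (u,v) \<in> B \<Longrightarrow> i (u,v) \<in> A \<and> j (i (u,v)) = (u,v)"
    and "\<And>k m u v. (k,m) \<in> A \<Longrightarrow> j (k,m) = (u,v) \<Longrightarrow> t' * u\<^sup>2 + s' * v\<^sup>2 = t * k\<^sup>2 + s * m\<^sup>2 \<and> w' u v = w k m"
  shows "theta2 w t s x A = theta2 w' t' s' x B"
  unfolding theta2_def
  by (rule infsum_reindex_bij_witness[where i = i and j = j]) (use assms in \<open>auto split: prod.splits\<close>)

lemma theta2_flip:
  assumes "\<And>k m. w k (-m) = w k m"
  shows "theta2 w t s x {(k,m). P k (-m)} = theta2 w t s x {(k,m). P k m}"
  by (rule theta2_reindex[where i = "\<lambda>(k,m). (k,-m)" and j = "\<lambda>(k,m). (k,-m)"]) (auto simp: assms)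

lemma theta2_flip_odd:
  assumes "\<And>k m. w k (-m) = - w k m"
  shows "theta2 w t s x {(k,m). P k (-m)} = - theta2 w t s x {(k,m). P k m}"
  unfolding theta2_uminus[symmetric]
  by (rule theta2_reindex[where i = "\<lambda>(k,m). (k,-m)" and j = "\<lambda>(k,m). (k,-m)"]) (auto simp: assms)

text \<open>On k = \<alpha> n + \<beta>, expanding the square turns the series into a triple product
  with base \<open>Q\<close>. By evenness the class of -\<beta> contributes the same amount; the
  classes are disjoint because \<alpha> cannot divide 2 \<beta>. Hence the factor 2.\<close>

lemma theta_triple_product:
  fixes t \<alpha> \<beta> e :: int
  assumes x: "norm x < 1" "x \<noteq> 0" and pos: "t > 0" "\<alpha> > 0" "\<beta> > 0" "2 * \<beta> < \<alpha>" and e: "e = 1 \<or> e = -1"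
    and c: "\<And>k. c (- k) = c k" "\<And>n. c (\<alpha> * n + \<beta>) = (if even n then 1 else e)"
      "\<And>k. \<not> \<alpha> dvd k - \<beta> \<Longrightarrow> \<not> \<alpha> dvd k + \<beta> \<Longrightarrow> c k = 0"
    and Q: "Q = x ^ nat (2 * t * \<alpha>\<^sup>2)"
  shows "theta c t x = 2 * x ^ nat (t * \<beta>\<^sup>2) *
    (qpoch_inf (- of_int e * x ^ nat (t * \<alpha> * (\<alpha> + 2 * \<beta>))) Q *
     qpoch_inf (- of_int e * x ^ nat (t * \<alpha> * (\<alpha> - 2 * \<beta>))) Q * qpoch_inf Q Q)"
proof -
  let ?f = "\<lambda>k. of_int (c k) * x ^ nat (t * k\<^sup>2)"
  define z where "z = - of_int e * x ^ nat (t * \<alpha> * (\<alpha> + 2 * \<beta>))"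
  have powi: "x ^ nat k = x powi k" if "k \<ge> 0" for k
    using that by (simp add: power_int_def)
  have Q': "Q = x powi (2 * t * \<alpha>\<^sup>2)" using pos by (simp add: Q powi)
  have z': "z = - of_int e * x powi (t * \<alpha> * (\<alpha> + 2 * \<beta>))" using pos by (simp add: z_def powi)
  have "2 * t * \<alpha>\<^sup>2 > 0" using pos by (intro mult_pos_pos) auto
  hence "nat (2 * t * \<alpha>\<^sup>2) \<noteq> 0" by linarith
  hence nQ: "norm Q < 1" "Q \<noteq> 0"
    using x power_less_one_iff[of "norm x" "nat (2 * t * \<alpha>\<^sup>2)"] by (auto simp: Q norm_power)
  have z0: "z \<noteq> 0" using x e by (auto simp: z_def)
  have Qz: "Q / z = - of_int e * x ^ nat (t * \<alpha> * (\<alpha> - 2 * \<beta>))"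
  proof -
    have "t * \<alpha> * (\<alpha> - 2 * \<beta>) = 2 * t * \<alpha>\<^sup>2 - t * \<alpha> * (\<alpha> + 2 * \<beta>)"
      by (simp add: algebra_simps power2_eq_square)
    moreover have "0 \<le> t * \<alpha> * (\<alpha> - 2 * \<beta>)" using pos by simp
    ultimately have "x ^ nat (t * \<alpha> * (\<alpha> - 2 * \<beta>)) = Q / x powi (t * \<alpha> * (\<alpha> + 2 * \<beta>))"
      using x by (simp add: powi Q' power_int_diff)
    thus ?thesis using e by (auto simp: z')
  qed
  have term_eq: "x ^ nat (t * \<beta>\<^sup>2) * ((-1) powi k * Q powi (k * (k - 1) div 2) * z powi k) = ?f (\<alpha> * k + \<beta>)" for k
  proof -
    have s: "(-1) powi k * (- of_int e) powi k = (of_int (c (\<alpha> * k + \<beta>)) :: complex)"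
      using e by (auto simp: c(2) power_int_minus_left)
    have "2 * (k * (k - 1) div 2) = k * (k - 1)"
      by simp
    hence "2 * t * \<alpha>\<^sup>2 * (k * (k - 1) div 2) = t * \<alpha>\<^sup>2 * (k * (k - 1))"
      by (metis mult.assoc mult.left_commute)
    hence "t * \<beta>\<^sup>2 + 2 * t * \<alpha>\<^sup>2 * (k * (k - 1) div 2) + t * \<alpha> * (\<alpha> + 2 * \<beta>) * k = t * (\<alpha> * k + \<beta>)\<^sup>2"
      by (simp add: algebra_simps power2_eq_square)
    hence "x powi (t * \<beta>\<^sup>2) * x powi (2 * t * \<alpha>\<^sup>2 * (k * (k - 1) div 2)) * x powi (t * \<alpha> * (\<alpha> + 2 * \<beta>) * k)
        = x powi (t * (\<alpha> * k + \<beta>)\<^sup>2)"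
      using x(2) by (metis power_int_add)
    moreover have "Q powi (k * (k - 1) div 2) = x powi (2 * t * \<alpha>\<^sup>2 * (k * (k - 1) div 2))"
      unfolding Q' by (simp add: power_int_mult)
    moreover have "z powi k = (- of_int e) powi k * x powi (t * \<alpha> * (\<alpha> + 2 * \<beta>) * k)"
      unfolding z' power_int_mult_distrib by (simp only: power_int_mult)
    moreover have "x ^ nat (t * \<beta>\<^sup>2) = x powi (t * \<beta>\<^sup>2)" "x ^ nat (t * (\<alpha> * k + \<beta>)\<^sup>2) = x powi (t * (\<alpha> * k + \<beta>)\<^sup>2)"
      using pos by (simp_all add: powi)
    ultimately show ?thesis
      unfolding s[symmetric] by (simp only: mult_ac)
  qed
  define R where "R = x ^ nat (t * \<beta>\<^sup>2) * (qpoch_inf z Q * qpoch_inf (Q / z) Q * qpoch_inf Q Q)"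
  have R: "((\<lambda>k. ?f (\<alpha> * k + \<beta>)) has_sum R) UNIV"
    unfolding term_eq[symmetric] R_def
    by (intro has_sum_cmult_right jacobi_triple_product nQ z0)
  let ?A = "{k. \<alpha> dvd k - \<beta>}" and ?B = "{k. \<alpha> dvd k + \<beta>}"
  have A: "(?f has_sum R) ?A"
  proof -
    have "(?f has_sum R) ?A \<longleftrightarrow> ((\<lambda>n. ?f (\<alpha> * n + \<beta>)) has_sum R) UNIV"
      by (rule has_sum_reindex_bij_witness[where j = "\<lambda>k. (k - \<beta>) div \<alpha>" and i = "\<lambda>n. \<alpha> * n + \<beta>"])
         (use pos in auto)
    thus ?thesis using R by simp
  qed
  have "\<alpha> dvd - k - \<beta> \<longleftrightarrow> \<alpha> dvd k + \<beta>" for k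
    using dvd_minus_iff[of \<alpha> "k + \<beta>"] by simp
  moreover have "\<alpha> dvd - k + \<beta> \<longleftrightarrow> \<alpha> dvd k - \<beta>" for k
    using dvd_minus_iff[of \<alpha> "k - \<beta>"] by simp
  ultimately have "(?f has_sum R) ?B \<longleftrightarrow> (?f has_sum R) ?A"
    by (intro has_sum_reindex_bij_witness[where j = uminus and i = uminus]) (simp_all add: c(1))
  with A have B: "(?f has_sum R) ?B" by simp
  have "?A \<inter> ?B = {}"
  proof -
    have False if "\<alpha> dvd k - \<beta>" "\<alpha> dvd k + \<beta>" for k
    proof -
      have "\<alpha> dvd (k + \<beta>) - (k - \<beta>)" using dvd_diff[OF that(2,1)] .
      hence "\<alpha> dvd 2 * \<beta>" by simp
      thus False using pos zdvd_imp_le[of \<alpha> "2 * \<beta>"] by linarith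
    qed
    thus ?thesis by auto
  qed
  from has_sum_Un_disjoint[OF A B this] have "(?f has_sum (R + R)) (?A \<union> ?B)" .
  moreover have "(?f has_sum (R + R)) (?A \<union> ?B) \<longleftrightarrow> (?f has_sum (R + R)) UNIV"
    by (rule has_sum_cong_neutral) (auto simp: c(3))
  ultimately have "theta c t x = R + R"
    unfolding theta_def by (intro infsumI) blast
  thus ?thesis unfolding R_def Qz unfolding z_def by simp
qed

text \<open>The analogue of \<open>theta_triple_product\<close> for \<alpha> = 1 and \<beta> = 0:
  the two classes coincide, so the factor 2 disappears.\<close>

lemma theta_alternating:
  assumes "norm x < 1" "x \<noteq> 0" "t > 0"
  shows "theta (\<lambda>n. if even n then 1 else -1) t x =
    qpoch_inf (x ^ nat t) (x ^ nat (2 * t)) * qpoch_inf (x ^ nat t) (x ^ nat (2 * t)) *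
    qpoch_inf (x ^ nat (2 * t)) (x ^ nat (2 * t))"
proof -
  let ?Q = "x ^ nat (2 * t)" and ?z = "x ^ nat t"
  have nQ: "norm ?Q < 1" "?Q \<noteq> 0"
    using assms power_less_one_iff[of "norm x" "nat (2 * t)"] by (auto simp: norm_power)
  have "nat (2 * t) = nat t + nat t"
    using assms(3) by linarith
  hence z0: "?z \<noteq> 0" and Qz: "?Q / ?z = ?z"
    using assms(2) by (simp_all add: power_add)
  have "(-1) powi k * ?Q powi (k * (k - 1) div 2) * ?z powi k = of_int (if even k then 1 else -1) * x ^ nat (t * k\<^sup>2)" for k
  proof -
    have "2 * (k * (k - 1) div 2) = k * (k - 1)" by simp
    hence "2 * t * (k * (k - 1) div 2) = t * (k * (k - 1))"
      by (metis mult.assoc mult.left_commute)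
    hence "2 * t * (k * (k - 1) div 2) + t * k = t * k\<^sup>2"
      by (simp add: algebra_simps power2_eq_square)
    hence "x powi (2 * t * (k * (k - 1) div 2)) * x powi (t * k) = x powi (t * k\<^sup>2)"
      using assms(2) by (metis power_int_add)
    moreover have "?Q = x powi (2 * t)" "?z = x powi t" "x ^ nat (t * k\<^sup>2) = x powi (t * k\<^sup>2)"
      using assms(3) by (simp_all add: power_int_def)
    moreover have "(-1 :: complex) powi k = of_int (if even k then 1 else -1)"
      by (simp add: power_int_minus_left)
    ultimately show ?thesis
      by (simp only: power_int_mult mult.assoc)
  qed
  thus ?thesis
    unfolding theta_def using infsumI[OF jacobi_triple_product[OF nQ z0]] by (simp only: Qz)
qed

subsection \<open>The periodic weights\<close>

definition chi3 :: "int \<Rightarrow> int" where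
  "chi3 k = (if k mod 3 = 1 then 1 else if k mod 3 = 2 then -1 else 0)"

definition chi4 :: "int \<Rightarrow> int" where
  "chi4 k = (if k mod 4 = 1 then 1 else if k mod 4 = 3 then -1 else 0)"

text \<open>Together with \<open>rr2\<close> this spans the odd functions modulo 5; the determinant
  of the pair is \<open>rr_pairing\<close>.\<close>

definition rr1 :: "int \<Rightarrow> int" where
  "rr1 k = (if k mod 5 = 1 then 1 else if k mod 5 = 4 then -1 else 0)"

definition rr2 :: "int \<Rightarrow> int" where
  "rr2 k = (if k mod 5 = 2 then 1 else if k mod 5 = 3 then -1 else 0)"

definition oct3 :: "int \<Rightarrow> int" where
  "oct3 k = (if k mod 8 = 3 \<or> k mod 8 = 5 then 1 else 0)"

text \<open>The values are (-1)^n at 8n + 1 and 8n - 1, the form that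
  \<open>theta_triple_product\<close> takes; \<open>sgn3\<close> does the same at 8n + 3 and 8n -
  3.\<close>

definition sgn1 :: "int \<Rightarrow> int" where
  "sgn1 k = (if k mod 16 = 1 \<or> k mod 16 = 15 then 1 else if k mod 16 = 7 \<or> k mod 16 = 9 then -1 else 0)"

definition sgn3 :: "int \<Rightarrow> int" where
  "sgn3 k = (if k mod 16 = 3 \<or> k mod 16 = 13 then 1 else if k mod 16 = 5 \<or> k mod 16 = 11 then -1 else 0)"

definition alt :: "int \<Rightarrow> int" where
  "alt n = (if even n then 1 else -1)"

lemmas weight_defs = chi3_def chi4_def rr1_def rr2_def oct3_def sgn1_def sgn3_def alt_def

lemma abs_weight_le_1 [simp]:
  "\<bar>chi3 k\<bar> \<le> 1" "\<bar>chi4 k\<bar> \<le> 1" "\<bar>rr1 k\<bar> \<le> 1" "\<bar>rr2 k\<bar> \<le> 1" "\<bar>oct3 k\<bar> \<le> 1" 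
  "\<bar>sgn1 k\<bar> \<le> 1" "\<bar>sgn3 k\<bar> \<le> 1" "\<bar>alt k\<bar> \<le> 1"
  by (simp_all add: weight_defs)

lemma abs_mult_le_1: "\<bar>a\<bar> \<le> 1 \<Longrightarrow> \<bar>b\<bar> \<le> 1 \<Longrightarrow> \<bar>a * b\<bar> \<le> (1::int)"
  using mult_mono[of "\<bar>a\<bar>" 1 "\<bar>b\<bar>" 1] by (simp add: abs_mult)

lemma abs_uminus_le_1: "\<bar>a\<bar> \<le> 1 \<Longrightarrow> \<bar>- a\<bar> \<le> (1::int)"
  by simp

text \<open>The determinant is nonzero exactly when one residue is 1 or -1 and the other 2 or -2,
  which means k = 2m or k = -2m with m a unit modulo 5. If 5 divides both k and m, the two
  indicators cancel.\<close>

lemma rr_pairing: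
  "rr1 k * rr2 m - rr2 k * rr1 m = (if 5 dvd k + 2 * m then 1 else 0) - (if 5 dvd k - 2 * m then 1 else 0)"
proof -
  have *: "k mod 5 = 0 \<or> k mod 5 = 1 \<or> k mod 5 = 2 \<or> k mod 5 = 3 \<or> k mod 5 = 4" for k :: int
    by presburger
  have "5 dvd k + 2 * m \<longleftrightarrow> (k mod 5 + 2 * (m mod 5)) mod 5 = 0"
       "5 dvd k - 2 * m \<longleftrightarrow> (k mod 5 - 2 * (m mod 5)) mod 5 = 0"
    by presburger+
  with *[of k] *[of m] show ?thesis
    unfolding rr1_def rr2_def by (elim disjE) simp_all
qed

text \<open>A determinant of theta series becomes one sublattice sum: as \<open>g\<close> is odd, m
  -> -m exchanges the two congruences of \<open>rr_pairing\<close> with a change of sign, which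
  produces the factor 2.\<close>

lemma theta_rr_pairing:
  assumes "norm x < 1" "t > 0" "s > 0" "\<And>k. \<bar>f k\<bar> \<le> 1" "\<And>k. \<bar>g k\<bar> \<le> 1" "\<And>k. g (- k) = - g k"
  shows "theta (\<lambda>k. f k * rr1 k) t x * theta (\<lambda>k. g k * rr2 k) s x
       - theta (\<lambda>k. f k * rr2 k) t x * theta (\<lambda>k. g k * rr1 k) s x
       = 2 * theta2 (\<lambda>k m. f k * g m) t s x {(k,m). 5 dvd k + 2 * m}"
proof -
  note bd = abs_mult_le_1 abs_weight_le_1 assms(4,5)
  let ?w = "\<lambda>k m. f k * g m"
  have "theta (\<lambda>k. f k * rr1 k) t x * theta (\<lambda>k. g k * rr2 k) s x
       - theta (\<lambda>k. f k * rr2 k) t x * theta (\<lambda>k. g k * rr1 k) s x =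
     theta2 (\<lambda>k m. f k * rr1 k * (g m * rr2 m) - f k * rr2 k * (g m * rr1 m)) t s x UNIV"
    by (subst theta2_diff) (use assms(1-3) in \<open>auto intro!: bd simp: theta_mult bd\<close>)
  also have "\<dots> = theta2 (\<lambda>k m. (if 5 dvd k + 2 * m then ?w k m else 0) - (if 5 dvd k - 2 * m then ?w k m else 0)) t s x UNIV"
  proof (rule theta2_cong_neutral)
    fix k m
    have "f k * rr1 k * (g m * rr2 m) - f k * rr2 k * (g m * rr1 m) = ?w k m * (rr1 k * rr2 m - rr2 k * rr1 m)"
      by (simp add: algebra_simps)
    thus "f k * rr1 k * (g m * rr2 m) - f k * rr2 k * (g m * rr1 m) =
        (if 5 dvd k + 2 * m then ?w k m else 0) - (if 5 dvd k - 2 * m then ?w k m else 0)"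
      unfolding rr_pairing by simp
  qed auto
  also have "\<dots> = theta2 (\<lambda>k m. if 5 dvd k + 2 * m then ?w k m else 0) t s x UNIV
                - theta2 (\<lambda>k m. if 5 dvd k - 2 * m then ?w k m else 0) t s x UNIV"
    by (rule theta2_diff) (use assms(1-3) in \<open>auto intro!: bd\<close>)
  also have "\<dots> = theta2 ?w t s x {(k,m). 5 dvd k + 2 * m} - theta2 ?w t s x {(k,m). 5 dvd k - 2 * m}"
    by (intro arg_cong2[where f = minus] theta2_cong_neutral) auto
  also have "theta2 ?w t s x {(k,m). 5 dvd k - 2 * m} = - theta2 ?w t s x {(k,m). 5 dvd k + 2 * m}"
    using theta2_flip_odd[of ?w t s x "\<lambda>k m. 5 dvd k + 2 * m"] assms(6) by simp
  finally show ?thesis by simp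
qed

text \<open>On the support of the weight exactly one of k = m and k = -m holds modulo 3, and m -> -m
  exchanges the two halves.\<close>

lemma theta2_split_mod3:
  assumes "norm x < 1" "t > 0" "s > 0" "\<And>k m. \<bar>w k m\<bar> \<le> 1" "\<And>k m. w k (-m) = w k m"
    and "\<And>k m. 3 dvd k \<or> 3 dvd m \<Longrightarrow> w k m = 0"
  shows "theta2 w t s x UNIV = 2 * theta2 w t s x {(k,m). 3 dvd k + m \<and> \<not> 3 dvd m}"
    "theta2 w t s x UNIV = 2 * theta2 w t s x {(k,m). 3 dvd k - m \<and> \<not> 3 dvd m}"
proof -
  let ?A = "{(k,m). 3 dvd k + m \<and> \<not> 3 dvd m} :: (int \<times> int) set"
  let ?B = "{(k,m). 3 dvd k - m \<and> \<not> 3 dvd m} :: (int \<times> int) set"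
  have "(k,m) \<in> ?A \<union> ?B" if "\<not> 3 dvd k" "\<not> 3 dvd m" for k m :: int
    using that by simp presburger
  hence "theta2 w t s x UNIV = theta2 w t s x (?A \<union> ?B)"
    by (intro theta2_cong_neutral) (use assms(6) in blast)+
  moreover have "(k,m) \<notin> ?A \<inter> ?B" for k m :: int
    by simp presburger
  hence "?A \<inter> ?B = {}" by blast
  ultimately have *: "theta2 w t s x UNIV = theta2 w t s x ?A + theta2 w t s x ?B"
    using theta2_Un[OF assms(1-4)] by simp
  have "theta2 w t s x ?A = theta2 w t s x ?B"
    using assms(5) theta2_flip[of w t s x "\<lambda>k m. 3 dvd k - m \<and> \<not> 3 dvd m"] by simp
  with * show "theta2 w t s x UNIV = 2 * theta2 w t s x ?A" "theta2 w t s x UNIV = 2 * theta2 w t s x ?B"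
    by simp_all
qed

text \<open>With \<open>q = x\<^sup>2\<^sup>4\<^sup>0\<close>, up to a factor \<open>2x\<^sup>n\<close> the series of \<open>wT \<sqdot> rr1\<close> is the left-hand side of the
  theorem, those of \<open>chi4 \<sqdot> rr1\<close> and \<open>chi4 \<sqdot> rr2\<close> are the numerators of the two Rogers-Ramanujan
  functions, and that of \<open>wN\<close> is the numerator of the right-hand side of the theorem.\<close>

abbreviation "wT k \<equiv> - (chi3 k * oct3 k)"
abbreviation "wN k \<equiv> - (chi3 k * chi4 k * oct3 k)"
text \<open>Squares of characters are indicators of their support, so \<open>wY\<close> is (-1)^n at
  3n + 1 and 3n - 1, and \<open>wP\<close> is the indicator of the odd integers.\<close>

abbreviation "wY v \<equiv> - (chi3 v * chi3 v * alt v)"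
abbreviation "wP j \<equiv> chi4 j * chi4 j"

section \<open>Parity, periodicity and support of the weights\<close>

lemma chi4_uminus [simp]: "chi4 (- k) = - chi4 k"
  unfolding chi4_def by presburger

lemma chi3_uminus [simp]: "chi3 (- k) = - chi3 k"
  unfolding chi3_def by presburger

lemma mod_16_cases:
  fixes k :: int
  obtains "k mod 16 = 0" | "k mod 16 = 1" | "k mod 16 = 2" | "k mod 16 = 3" | "k mod 16 = 4" | "k mod 16 = 5"
    | "k mod 16 = 6" | "k mod 16 = 7" | "k mod 16 = 8" | "k mod 16 = 9" | "k mod 16 = 10" | "k mod 16 = 11"
    | "k mod 16 = 12" | "k mod 16 = 13" | "k mod 16 = 14" | "k mod 16 = 15"
proof -
  have "k mod 16 \<in> {0..15}" by auto
  also have "{0..15::int} = {0,1,2,3,4,5,6,7,8,9,10,11,12,13,14,15}" by (simp add: simp_from_to)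
  finally show ?thesis by (elim insertE emptyE) (fact that)+
qed

lemma sgn1_uminus: "sgn1 (- k) = sgn1 k"
  unfolding sgn1_def zmod_zminus1_eq_if[of k] by (cases k rule: mod_16_cases) simp_all

lemma sgn3_uminus: "sgn3 (- k) = sgn3 k"
  unfolding sgn3_def zmod_zminus1_eq_if[of k] by (cases k rule: mod_16_cases) simp_all

lemma sgn3_add_8: "sgn3 (k + 8) = - sgn3 k"
proof -
  have "(k + 8) mod 16 = (k mod 16 + 8) mod 16" by (simp add: mod_simps)
  thus ?thesis
    unfolding sgn3_def by (cases k rule: mod_16_cases) simp_all
qed

lemma sgn1_add_16: "sgn1 (k + 16 * j) = sgn1 k"
  unfolding sgn1_def by simp

lemma sgn3_add_16: "sgn3 (k + 16 * j) = sgn3 k"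
  unfolding sgn3_def by simp

lemma sgn1_sgn3_mod_8:
  assumes "sgn1 s \<noteq> 0" "sgn3 t \<noteq> 0"
  shows "s mod 8 = 1 \<or> s mod 8 = 7" "t mod 8 = 3 \<or> t mod 8 = 5"
proof -
  have *: "k mod 8 = k mod 16 mod 8" for k :: int by (simp add: mod_mod_cancel)
  show "s mod 8 = 1 \<or> s mod 8 = 7"
    unfolding *[of s] using assms(1) unfolding sgn1_def by (cases s rule: mod_16_cases) simp_all
  show "t mod 8 = 3 \<or> t mod 8 = 5"
    unfolding *[of t] using assms(2) unfolding sgn3_def by (cases t rule: mod_16_cases) simp_all
qed

text \<open>Evaluates the weight of the pairs \<open>(4 * w - t, t)\<close> that occur in
  \<open>quintuple_rotation\<close>. For odd \<open>w\<close>, \<open>4 * w\<close> modulo 16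
  depends only on \<open>w\<close> modulo 4, so finitely many residues decide it.\<close>

lemma sgn1_mult_sgn3:
  assumes "odd w" "t mod 8 = 3 \<or> t mod 8 = 5"
  shows "sgn1 (4 * w - t) * sgn3 t = - (chi4 t * chi4 w)"
proof -
  have m: "t mod 8 = t mod 16 mod 8" "t mod 4 = t mod 16 mod 4" by (simp_all add: mod_mod_cancel)
  have "(4 * w) mod 16 = 4 * (w mod 4)" using mult_mod_right[of 4 w 4] by simp
  hence d: "(4 * w - t) mod 16 = (4 * (w mod 4) - t mod 16) mod 16"
    by (metis mod_diff_eq mod_mod_trivial)
  have "w mod 4 = 1 \<or> w mod 4 = 3" using assms(1) by presburger
  note w = disjE[OF this]
  consider "t mod 16 = 3" | "t mod 16 = 5" | "t mod 16 = 11" | "t mod 16 = 13"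
    using assms(2) unfolding m(1) by (cases t rule: mod_16_cases) simp_all
  thus ?thesis
    unfolding sgn1_def sgn3_def chi4_def m(2) d by cases (rule w; simp)+
qed

lemma chi3_add_3: "chi3 (k + 3 * j) = chi3 k"
  unfolding chi3_def by simp

lemma chi4_add_4: "chi4 (k + 4 * j) = chi4 k"
  unfolding chi4_def by simp

lemma chi4_add_2: "chi4 (k + 2) = - chi4 k"
  unfolding chi4_def by presburger

text \<open>A shift by 2 reverses \<open>chi4\<close>; this is how \<open>alt\<close> enters the
  rotated weights.\<close>

lemma chi4_add_double: "chi4 (k + 2 * j) = chi4 k * alt j"
proof (cases "even j")
  case True
  then obtain b where "j = 2 * b" by (rule evenE)
  thus ?thesis using chi4_add_4[of k b] by (simp add: alt_def)
next
  case False
  then obtain b where "j = 2 * b + 1" by (rule oddE)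
  thus ?thesis using chi4_add_4[of "k + 2" b] chi4_add_2[of k] by (simp add: alt_def algebra_simps)
qed

lemma oct3_add_8: "oct3 (k + 8 * j) = oct3 k"
  unfolding oct3_def by simp

lemma chi4_even: "even k \<Longrightarrow> chi4 k = 0"
  unfolding chi4_def by presburger

lemma oct3_even: "even k \<Longrightarrow> oct3 k = 0"
  unfolding oct3_def by presburger

lemma chi3_eq_0: "3 dvd k \<Longrightarrow> chi3 k = 0"
  unfolding chi3_def by auto

lemma alt_uminus [simp]: "alt (- k) = alt k"
  by (simp add: alt_def)

subsection \<open>Rotations of binary lattices\<close>

text \<open>The form \<open>k\<^sup>2 + 6m\<^sup>2\<close> is preserved by the map sending \<open>k + m\<surd>-6\<close> to \<open>(k - m\<surd>-6)(1 + 2\<surd>-6)/5\<close>,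
  and on the pairs with \<open>5 dvd k + 2m\<close> this map reverses the sign of the weight.\<close>

lemma rr_proportional:
  assumes "norm x < 1"
  shows "theta (\<lambda>k. wT k * rr1 k) 1 x * theta (\<lambda>k. chi4 k * rr2 k) 6 x
       = theta (\<lambda>k. wT k * rr2 k) 1 x * theta (\<lambda>k. chi4 k * rr1 k) 6 x"
proof -
  let ?U = "{(k,m). 5 dvd k + 2 * m} :: (int \<times> int) set"
  let ?w = "\<lambda>k m. wT k * chi4 m"
  let ?r = "\<lambda>(k,m). ((k + 12 * m) div 5, (2 * k - m) div 5) :: int \<times> int"
  \<comment> \<open>With k = 5a - 2m parametrizing \<open>?U\<close>, both divisions by 5 are
    exact.\<close>
  have r: "?r (5 * a - 2 * m, m) = (a + 2 * m, 2 * a - m)" for a m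
    by (auto simp: algebra_simps)
  have param: "\<exists>a. k = 5 * a - 2 * m" if "(k,m) \<in> ?U" for k m
    using that by (auto elim!: dvdE) (metis add_diff_cancel_right')
  have w: "?w (a + 2 * m) (2 * a - m) = - ?w (5 * a - 2 * m) m" for a m
  proof -
    have "chi3 (5 * a - 2 * m) = - chi3 (a + 2 * m)"
      using chi3_add_3[of "- (a + 2 * m)" "2 * a"] chi3_uminus[of "a + 2 * m"] by (simp add: algebra_simps)
    \<comment> \<open>For odd a and m the two arguments of \<open>oct3\<close> differ by 4(a - m), a
      multiple of 8; in every other case both sides vanish.\<close>
    moreover have "oct3 (a + 2 * m) * chi4 (2 * a - m) = oct3 (5 * a - 2 * m) * chi4 m"
    proof (cases "odd a \<and> odd m")
      case True
      then obtain b c where "a = 2 * b + 1" "m = 2 * c + 1" by (auto elim!: oddE)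
      hence "oct3 (a + 2 * m) = oct3 (5 * a - 2 * m)" "chi4 (2 * a - m) = chi4 m"
        using oct3_add_8[of "a + 2 * m" "b - c"] chi4_add_4[of m "b - c"] by (simp_all add: algebra_simps)
      thus ?thesis by simp
    next
      case False
      thus ?thesis
        using oct3_even[of "a + 2 * m"] oct3_even[of "5 * a - 2 * m"] chi4_even[of m] chi4_even[of "2 * a - m"]
        by auto
    qed
    ultimately show ?thesis by (simp add: mult.assoc)
  qed
  have "theta2 ?w 1 6 x ?U = theta2 (\<lambda>k m. - ?w k m) 1 6 x ?U"
  proof (rule theta2_reindex[where i = ?r and j = ?r])
    fix k m :: int assume "(k,m) \<in> ?U"
    then obtain a where a: "k = 5 * a - 2 * m" using param by blast
    have "?r (a + 2 * m, 2 * a - m) = (5 * a - 2 * m, m)"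
      by (auto simp: algebra_simps)
    thus rr: "?r (k,m) \<in> ?U \<and> ?r (?r (k,m)) = (k,m)"
      unfolding a r by (auto simp: algebra_simps; presburger)
    fix u v assume "?r (k,m) = (u,v)"
    hence uv: "u = a + 2 * m" "v = 2 * a - m" unfolding a r by auto
    show "1 * u\<^sup>2 + 6 * v\<^sup>2 = 1 * k\<^sup>2 + 6 * m\<^sup>2 \<and> - ?w u v = ?w k m"
      unfolding uv a w by (simp add: algebra_simps power2_eq_square)
  next
    fix k m :: int assume "(k,m) \<in> ?U"
    then obtain a where a: "k = 5 * a - 2 * m" using param by blast
    have "?r (a + 2 * m, 2 * a - m) = (5 * a - 2 * m, m)"
      by (auto simp: algebra_simps)
    thus "?r (k,m) \<in> ?U \<and> ?r (?r (k,m)) = (k,m)"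
      unfolding a r by (auto simp: algebra_simps; presburger)
  qed
  \<comment> \<open>The sum equals its own negative.\<close>
  hence "theta2 ?w 1 6 x ?U = 0"
    unfolding theta2_uminus by simp
  with theta_rr_pairing[of x 1 6 wT chi4] assms show ?thesis
    by (simp add: abs_mult_le_1)
qed

text \<open>The substitution is \<open>6m + k\<i> = (2 + \<i>)(u + 4v\<i>)\<close>.\<close>

lemma gaussian_rotation:
  assumes "norm x < 1"
  shows "theta (\<lambda>k. wT k * rr1 k) 1 x * theta (\<lambda>k. chi4 k * rr2 k) 36 x
       - theta (\<lambda>k. wT k * rr2 k) 1 x * theta (\<lambda>k. chi4 k * rr1 k) 36 x
       = - (theta wN 5 x * theta wY 80 x)"
proof -
  let ?U = "{(k,m). 5 dvd k + 2 * m} :: (int \<times> int) set"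
  let ?U' = "{(k,m). 5 dvd k + 2 * m \<and> odd k \<and> odd m} :: (int \<times> int) set"
  let ?V = "{(u,v). 3 dvd u + v \<and> \<not> 3 dvd v} :: (int \<times> int) set"
  let ?V' = "{(u,v). 3 dvd u + v \<and> odd u} :: (int \<times> int) set"
  let ?w = "\<lambda>k m. wT k * chi4 m" and ?w' = "\<lambda>u v. wN u * wY v"
  let ?j = "\<lambda>(k,m). ((k + 12 * m) div 5, (k - 3 * m) div 10) :: int \<times> int"
  let ?i = "\<lambda>(u,v). (u + 8 * v, (u - 2 * v) div 3) :: int \<times> int"
  have ji: "?j (3 * m + 10 * v, m) = (3 * m + 2 * v, v)" "?i (3 * m + 2 * v, v) = (3 * m + 10 * v, m)" for m v
    by (auto simp: algebra_simps)
  have w: "- ?w' (3 * m + 2 * v) v = ?w (3 * m + 10 * v) m" for m v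
  proof -
    have 1: "chi3 (3 * m + 10 * v) = chi3 v" "chi3 (3 * m + 2 * v) = - chi3 v"
      using chi3_add_3[of v "m + 3 * v"] chi3_add_3[of "- v" "m + v"] by (simp_all add: algebra_simps)
    have 2: "oct3 (3 * m + 10 * v) = oct3 (3 * m + 2 * v)"
      using oct3_add_8[of "3 * m + 2 * v" v] by (simp add: algebra_simps)
    have 3: "chi4 (3 * m + 2 * v) = - (chi4 m * alt v)"
      using chi4_add_double[of "3 * m" v] chi4_add_4[of "- m" m] by simp
    have "chi3 v = 0 \<or> chi3 v = 1 \<or> chi3 v = -1" "alt v = 1 \<or> alt v = -1"
      by (simp_all add: chi3_def alt_def)
    thus ?thesis unfolding 1 2 3 by (elim disjE) simp_all
  qed
  \<comment> \<open>The weight vanishes unless k and m are odd; then 5 dividing k + 2m amounts to 10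
    dividing k - 3m, which makes v integral.\<close>
  have "theta2 ?w 1 36 x ?U = theta2 ?w 1 36 x ?U'"
  proof (rule theta2_cong_neutral)
    fix k m assume "(k,m) \<in> ?U - ?U'"
    thus "?w k m = 0" using oct3_even[of k] chi4_even[of m] by auto
  qed auto
  also have "\<dots> = theta2 (\<lambda>u v. - ?w' u v) 5 80 x ?V'"
  proof (rule theta2_reindex[where i = ?i and j = ?j])
    fix k m :: int assume km: "(k,m) \<in> ?U'"
    hence "10 dvd k - 3 * m" by simp presburger
    then obtain v where v: "k = 3 * m + 10 * v" by (auto elim!: dvdE simp: algebra_simps)
    show "?j (k,m) \<in> ?V' \<and> ?i (?j (k,m)) = (k,m)"
      unfolding v ji using km v by (auto; presburger)
    fix u v' assume "?j (k,m) = (u,v')"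
    hence "v' = v" "u = 3 * m + 2 * v" unfolding v ji by auto
    thus "5 * u\<^sup>2 + 80 * v'\<^sup>2 = 1 * k\<^sup>2 + 36 * m\<^sup>2 \<and> - ?w' u v' = ?w k m"
      using w[of m v] km unfolding v by (auto simp: algebra_simps power2_eq_square)
  next
    fix u v :: int assume uv: "(u,v) \<in> ?V'"
    hence "3 dvd u - 2 * v" by simp presburger
    then obtain m where m: "u = 3 * m + 2 * v" by (auto elim!: dvdE simp: algebra_simps)
    show "?i (u,v) \<in> ?U' \<and> ?j (?i (u,v)) = (u,v)"
      unfolding m ji using uv m by (auto; presburger)
  qed
  \<comment> \<open>The rotated weight vanishes at even u and when 3 divides v, so the domain can be
    changed to the one of \<open>theta2_split_mod3\<close>, which absorbs the factor 2.\<close>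
  also have "\<dots> = - theta2 ?w' 5 80 x ?V"
    unfolding theta2_uminus
  proof (intro arg_cong[where f = uminus] theta2_cong_neutral)
    fix u v assume "(u,v) \<in> ?V' - ?V"
    thus "?w' u v = 0" using chi3_eq_0[of v] by auto
  next
    fix u v assume "(u,v) \<in> ?V - ?V'"
    thus "?w' u v = 0" using oct3_even[of u] by auto
  qed auto
  finally have "2 * theta2 ?w 1 36 x ?U = - (2 * theta2 ?w' 5 80 x ?V)" by simp
  also have "2 * theta2 ?w' 5 80 x ?V = theta2 ?w' 5 80 x UNIV"
  proof (rule theta2_split_mod3(1)[symmetric])
    fix k m :: int assume "3 dvd k \<or> 3 dvd m"
    thus "?w' k m = 0" using chi3_eq_0[of k] chi3_eq_0[of m] by auto
  qed (use assms in \<open>auto intro!: abs_mult_le_1 abs_uminus_le_1 simp del: mult_minus_left mult_minus_right\<close>)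
  also have "\<dots> = theta wN 5 x * theta wY 80 x"
    by (rule theta_mult[symmetric]) (use assms in \<open>auto intro!: abs_mult_le_1\<close>)
  finally show ?thesis
    using theta_rr_pairing[of x 1 36 wT chi4] assms by (simp add: abs_mult_le_1)
qed

text \<open>The substitution is \<open>k + m\<surd>-6 = (\<surd>3 + \<surd>-2)(j\<surd>3 + 2n\<surd>-2)\<close>.\<close>

lemma phi_psi_rotation:
  assumes "norm x < 1"
  shows "theta (\<lambda>k. chi4 k * rr1 k) 6 x * theta (\<lambda>k. chi4 k * rr2 k) 36 x
       - theta (\<lambda>k. chi4 k * rr2 k) 6 x * theta (\<lambda>k. chi4 k * rr1 k) 36 x
       = - 2 * (theta alt 240 x * theta wP 90 x)"
proof -
  let ?U = "{(k,m). 5 dvd k + 2 * m} :: (int \<times> int) set"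
  let ?U' = "{(k,m). 5 dvd k + 2 * m \<and> odd k \<and> odd m} :: (int \<times> int) set"
  let ?V = "{(n,j). odd j} :: (int \<times> int) set"
  let ?w = "\<lambda>k m. chi4 k * chi4 m" and ?w' = "\<lambda>n j. alt n * wP j"
  let ?j = "\<lambda>(k,m). ((3 * m - k) div 10, (k + 2 * m) div 5) :: int \<times> int"
  let ?i = "\<lambda>(n,j). (3 * j - 4 * n, j + 2 * n) :: int \<times> int"
  have ji: "?j (3 * j - 4 * n, j + 2 * n) = (n, j)" for n j
    by (auto simp: algebra_simps)
  have w: "- ?w' n j = ?w (3 * j - 4 * n) (j + 2 * n)" for n j
  proof -
    have "chi4 (3 * j - 4 * n) = - chi4 j"
      using chi4_add_4[of "- j" "j - n"] by simp
    thus ?thesis unfolding chi4_add_double by (simp only: mult_ac mult_minus_left)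
  qed
  have "theta2 ?w 6 36 x ?U = theta2 ?w 6 36 x ?U'"
  proof (rule theta2_cong_neutral)
    fix k m assume "(k,m) \<in> ?U - ?U'"
    thus "?w k m = 0" using chi4_even[of k] chi4_even[of m] by auto
  qed auto
  also have "\<dots> = theta2 (\<lambda>n j. - ?w' n j) 240 90 x ?V"
  proof (rule theta2_reindex[where i = ?i and j = ?j])
    fix k m :: int assume km: "(k,m) \<in> ?U'"
    hence "10 dvd 3 * m - k" by simp presburger
    then obtain n where n: "k = 3 * m - 10 * n" by (auto elim!: dvdE simp: algebra_simps)
    define j where "j = m - 2 * n"
    have kj: "k = 3 * j - 4 * n" "m = j + 2 * n" by (auto simp: j_def n)
    show "?j (k,m) \<in> ?V \<and> ?i (?j (k,m)) = (k,m)"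
      unfolding kj ji using km by (auto simp: kj)
    fix u v assume "?j (k,m) = (u,v)"
    hence "u = n" "v = j" unfolding kj ji by auto
    thus "240 * u\<^sup>2 + 90 * v\<^sup>2 = 6 * k\<^sup>2 + 36 * m\<^sup>2 \<and> - ?w' u v = ?w k m"
      using w[of n j] km unfolding kj by (auto simp: algebra_simps power2_eq_square)
  next
    fix n j :: int assume nj: "(n,j) \<in> ?V"
    show "?i (n,j) \<in> ?U' \<and> ?j (?i (n,j)) = (n,j)"
      using nj ji by auto
  qed
  \<comment> \<open>Here j is only restricted to odd values, the support of \<open>wP\<close>, so
    the image fills the whole lattice and the factor 2 remains.\<close>
  also have "\<dots> = - theta2 ?w' 240 90 x UNIV"
    unfolding theta2_uminus
  proof (intro arg_cong[where f = uminus] theta2_cong_neutral)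
    fix u v assume "(u,v) \<in> UNIV - ?V"
    thus "?w' u v = 0" using chi4_even[of v] by auto
  qed auto
  also have "theta2 ?w' 240 90 x UNIV = theta alt 240 x * theta wP 90 x"
    by (rule theta_mult[symmetric]) (use assms in \<open>auto simp: chi4_def\<close>)
  finally show ?thesis
    using theta_rr_pairing[of x 6 36 chi4 chi4] assms by simp
qed

text \<open>A case of the quintuple product identity. The substitution is
  \<open>u + 4w\<surd>-2 = (1 + \<surd>-2)(s + t\<surd>-2)\<close>, and the pairs \<open>(s,t)\<close> with \<open>3 dvd s + t\<close> cancel.\<close>

lemma quintuple_rotation:
  assumes "norm x < 1"
  shows "theta wN 5 x * theta (\<lambda>w. chi3 w * chi4 w) 160 x = theta sgn1 15 x * theta sgn3 30 x"
proof -
  let ?w = "\<lambda>s t. sgn1 s * sgn3 t" and ?w' = "\<lambda>u w. wN u * (chi3 w * chi4 w)"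
  let ?P = "{(s,t). 8 dvd s + t + 4 \<and> odd s} :: (int \<times> int) set"
  let ?P' = "{(s,t). 8 dvd s - t + 4 \<and> odd s} :: (int \<times> int) set"
  let ?Pz = "{(s,t). 8 dvd s + t + 4 \<and> odd s \<and> 3 dvd s + t} :: (int \<times> int) set"
  let ?Pn = "{(s,t). 8 dvd s + t + 4 \<and> odd s \<and> \<not> 3 dvd s + t} :: (int \<times> int) set"
  let ?V = "{(u,w). 3 dvd u - w \<and> \<not> 3 dvd w} :: (int \<times> int) set"
  let ?V' = "{(u,w). 3 dvd u - w \<and> \<not> 3 dvd w \<and> odd u \<and> odd w} :: (int \<times> int) set"
  have bd: "\<bar>?w s t\<bar> \<le> 1" "\<bar>?w' s t\<bar> \<le> 1" for s t
    by (intro abs_mult_le_1 abs_uminus_le_1; simp)+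
  have "theta sgn1 15 x * theta sgn3 30 x = theta2 ?w 15 30 x UNIV"
    by (rule theta_mult) (use assms in auto)
  \<comment> \<open>On the support, s is 1 or -1 and t is 3 or -3 modulo 8, so exactly one of s + t
    and s - t is 4 modulo 8.\<close>
  also have "\<dots> = theta2 ?w 15 30 x (?P \<union> ?P')"
  proof (rule theta2_cong_neutral)
    fix s t assume "(s,t) \<in> UNIV - (?P \<union> ?P')"
    hence "\<not> 8 dvd s + t + 4 \<and> \<not> 8 dvd s - t + 4 \<or> even s" by auto
    hence "sgn1 s = 0 \<or> sgn3 t = 0"
    proof
      assume "even s"
      hence "\<not> (s mod 8 = 1 \<or> s mod 8 = 7)" by presburger
      thus ?thesis using sgn1_sgn3_mod_8 by blast
    next
      assume *: "\<not> 8 dvd s + t + 4 \<and> \<not> 8 dvd s - t + 4"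
      have "\<not> ((s mod 8 = 1 \<or> s mod 8 = 7) \<and> (t mod 8 = 3 \<or> t mod 8 = 5))"
        using * by presburger
      thus ?thesis using sgn1_sgn3_mod_8 by blast
    qed
    thus "?w s t = 0" by auto
  qed auto
  also have "\<dots> = theta2 ?w 15 30 x ?P + theta2 ?w 15 30 x ?P'"
  proof (rule theta2_Un)
    have "(s,t) \<notin> ?P \<inter> ?P'" for s t :: int by simp presburger
    thus "?P \<inter> ?P' = {}" by blast
  qed (use assms bd in auto)
  also have "theta2 ?w 15 30 x ?P' = theta2 ?w 15 30 x ?P"
    using theta2_flip[of ?w 15 30 x "\<lambda>s t. 8 dvd s + t + 4 \<and> odd s"] sgn3_uminus by simp
  also have "?P = ?Pz \<union> ?Pn" by auto
  also have "theta2 ?w 15 30 x (?Pz \<union> ?Pn) = theta2 ?w 15 30 x ?Pz + theta2 ?w 15 30 x ?Pn"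
    by (rule theta2_Un) (use assms bd in auto)
  also have "theta2 ?w 15 30 x ?Pz = 0"
  proof -
    \<comment> \<open>This multiplies the conjugate of s + t sqrt(-2) by (1 + 2 sqrt(-2))/3, an
      element of norm 1; it is an involution of \<open>?Pz\<close> that reverses the sign of the
      weight.\<close>
    let ?r = "\<lambda>(s,t). ((s + 4 * t) div 3, (2 * s - t) div 3) :: int \<times> int"
    have r: "?r (12 * a - t, t) = (4 * a + t, 8 * a - t)" "?r (4 * a + t, 8 * a - t) = (12 * a - t, t)" for a t
      by (auto simp: algebra_simps)
    have w: "- ?w (4 * a + t) (8 * a - t) = ?w (12 * a - t) t" if "odd a" for a t
    proof -
      have "sgn1 (4 * a + t) = sgn1 (12 * a - t)"
        using sgn1_add_16[of "t - 12 * a" a] sgn1_uminus[of "12 * a - t"] by (simp add: algebra_simps)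
      moreover obtain b where "a = 2 * b + 1" using \<open>odd a\<close> by (rule oddE)
      hence "sgn3 (8 * a - t) = - sgn3 t"
        using sgn3_add_16[of "8 - t" b] sgn3_add_8[of "- t"] sgn3_uminus[of t] by (simp add: algebra_simps)
      ultimately show ?thesis by simp
    qed
    have param: "\<exists>a. s = 12 * a - t \<and> odd a \<and> odd t" if "(s,t) \<in> ?Pz" for s t
    proof -
      from that have "12 dvd s + t" by simp presburger
      then obtain a where "s = 12 * a - t" by (auto elim!: dvdE simp: algebra_simps)
      moreover from this that have "odd a" "odd t" by (auto; presburger)+
      ultimately show ?thesis by blast
    qed
    have "theta2 ?w 15 30 x ?Pz = theta2 (\<lambda>s t. - ?w s t) 15 30 x ?Pz"
    proof (rule theta2_reindex[where i = ?r and j = ?r])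
      fix s t :: int assume "(s,t) \<in> ?Pz"
      then obtain a where a: "s = 12 * a - t" "odd a" "odd t" using param by blast
      show "?r (s,t) \<in> ?Pz \<and> ?r (?r (s,t)) = (s,t)"
        unfolding a(1) r using a(2,3) by (auto; presburger)
      fix u v assume "?r (s,t) = (u,v)"
      hence uv: "u = 4 * a + t" "v = 8 * a - t" unfolding a(1) r by auto
      show "15 * u\<^sup>2 + 30 * v\<^sup>2 = 15 * s\<^sup>2 + 30 * t\<^sup>2 \<and> - ?w u v = ?w s t"
        unfolding uv a(1) w[OF a(2)] by (simp add: algebra_simps power2_eq_square)
    next
      fix s t :: int assume "(s,t) \<in> ?Pz"
      then obtain a where a: "s = 12 * a - t" "odd a" "odd t" using param by blast
      show "?r (s,t) \<in> ?Pz \<and> ?r (?r (s,t)) = (s,t)"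
        unfolding a(1) r using a(2,3) by (auto; presburger)
    qed
    thus ?thesis unfolding theta2_uminus by simp
  qed
  also have "theta2 ?w 15 30 x ?Pn = theta2 ?w' 5 160 x ?V'"
  proof -
    let ?j = "\<lambda>(s,t). (s - 2 * t, (s + t) div 4) :: int \<times> int"
    let ?i = "\<lambda>(u,w). ((u + 8 * w) div 3, (4 * w - u) div 3) :: int \<times> int"
    have ji: "?j (4 * w - t, t) = (4 * w - 3 * t, w)" "?i (4 * w - 3 * t, w) = (4 * w - t, t)" for w t
      by (auto simp: algebra_simps)
    have w: "?w' (4 * w - 3 * t) w = ?w (4 * w - t) t" if "odd w" "odd t" "\<not> 3 dvd w" for w t
    proof -
      have "chi3 (4 * w - 3 * t) = chi3 w" "chi4 (4 * w - 3 * t) = chi4 t"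
        using chi3_add_3[of w "w - t"] chi4_add_4[of t "w - t"] by simp_all
      moreover have "chi3 w * chi3 w = 1"
        using that(3) unfolding chi3_def by auto presburger
      ultimately have 1: "?w' (4 * w - 3 * t) w = - (chi4 t * oct3 (4 * w - 3 * t) * chi4 w)"
        by (simp add: mult_ac)
      \<comment> \<open>For odd w, 4w - 3t is 4 - 3t modulo 8, and \<open>oct3\<close> picks out
        exactly the classes 3 and 5 of t on which \<open>sgn3\<close> lives.\<close>
      obtain b where "w = 2 * b + 1" using \<open>odd w\<close> by (rule oddE)
      hence "oct3 (4 * w - 3 * t) = oct3 (4 - 3 * t)"
        using oct3_add_8[of "4 - 3 * t" b] by (simp add: algebra_simps)
      also have "\<dots> = (if t mod 8 = 3 \<or> t mod 8 = 5 then 1 else 0)"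
      proof -
        have "(4 - 3 * t) mod 8 = (4 - 3 * (t mod 8)) mod 8"
          by (metis mod_diff_right_eq mod_mult_right_eq)
        moreover have "t mod 8 = 1 \<or> t mod 8 = 3 \<or> t mod 8 = 5 \<or> t mod 8 = 7"
          using that(2) by presburger
        ultimately show ?thesis unfolding oct3_def by (elim disjE) simp_all
      qed
      finally have "oct3 (4 * w - 3 * t) = (if t mod 8 = 3 \<or> t mod 8 = 5 then 1 else 0)" .
      moreover have "sgn1 (4 * w - t) * sgn3 t = 0" if "\<not> (t mod 8 = 3 \<or> t mod 8 = 5)"
        using that sgn1_sgn3_mod_8[of "4 * w - t" t] by auto
      moreover note sgn1_mult_sgn3[OF that(1), of t]
      ultimately show ?thesis unfolding 1 by auto
    qed
    show ?thesis
    proof (rule theta2_reindex[where i = ?i and j = ?j])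
      fix s t :: int assume st: "(s,t) \<in> ?Pn"
      hence "4 dvd s + t" by simp presburger
      then obtain w where s: "s = 4 * w - t" by (auto elim!: dvdE simp: algebra_simps)
      have odd: "odd w" "odd t" "\<not> 3 dvd w" using st unfolding s by (auto; presburger)+
      show "?j (s,t) \<in> ?V' \<and> ?i (?j (s,t)) = (s,t)"
        unfolding s ji using odd by (auto; presburger)
      fix u v assume "?j (s,t) = (u,v)"
      hence uv: "u = 4 * w - 3 * t" "v = w" unfolding s ji by auto
      show "5 * u\<^sup>2 + 160 * v\<^sup>2 = 15 * s\<^sup>2 + 30 * t\<^sup>2 \<and> ?w' u v = ?w s t"
        unfolding uv s w[OF odd] by (simp add: algebra_simps power2_eq_square)
    next
      fix u w :: int assume uw: "(u,w) \<in> ?V'"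
      hence "3 dvd 4 * w - u" by simp presburger
      then obtain t where u: "u = 4 * w - 3 * t" by (auto elim!: dvdE simp: algebra_simps)
      have odd: "odd w" "odd t" "\<not> 3 dvd w" using uw unfolding u by auto
      show "?i (u,w) \<in> ?Pn \<and> ?j (?i (u,w)) = (u,w)"
        unfolding u ji using odd by (auto; presburger)
    qed
  qed
  also have "\<dots> = theta2 ?w' 5 160 x ?V"
  proof (rule theta2_cong_neutral)
    fix u w assume "(u,w) \<in> ?V - ?V'"
    thus "?w' u w = 0" using chi4_even[of u] chi4_even[of w] by auto
  qed auto
  also have "(0 + theta2 ?w' 5 160 x ?V) + (0 + theta2 ?w' 5 160 x ?V) = 2 * theta2 ?w' 5 160 x ?V"
    by simp
  also have "\<dots> = theta2 ?w' 5 160 x UNIV"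
  proof (rule theta2_split_mod3(2)[symmetric])
    fix k m :: int assume "3 dvd k \<or> 3 dvd m"
    thus "?w' k m = 0" using chi3_eq_0[of k] chi3_eq_0[of m] by auto
  qed (use assms bd in auto)
  also have "\<dots> = theta wN 5 x * theta (\<lambda>w. chi3 w * chi4 w) 160 x"
    by (rule theta_mult[symmetric]) (use assms in \<open>auto intro!: abs_mult_le_1\<close>)
  finally show ?thesis ..
qed

subsection \<open>Product formulas for the weighted theta series\<close>

text \<open>The factor \<open>chi4\<close> removes even arguments, leaving the classes 1 and -1
  modulo 10 with alternating sign. For q = x^240 the product is (q^2, q^3, q^5; q^5).\<close>

lemma theta_rogers_ramanujan:
  assumes "norm x < 1" "x \<noteq> 0"
  shows "theta (\<lambda>k. chi4 k * rr1 k) 6 x =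
    2 * x ^ 6 * (qpoch_inf (x ^ 720) (x ^ 1200) * qpoch_inf (x ^ 480) (x ^ 1200) * qpoch_inf (x ^ 1200) (x ^ 1200))"
proof -
  have "rr1 (10 * n + 1) = 1" for n unfolding rr1_def by presburger
  moreover have "chi4 (10 * n + 1) = alt n" for n
    using chi4_add_double[of 1 "5 * n"] by (simp add: chi4_def alt_def add.commute)
  moreover have "rr1 (- k) = - rr1 k" for k unfolding rr1_def by presburger
  moreover have "chi4 k * rr1 k = 0" if "\<not> 10 dvd k - 1" "\<not> 10 dvd k + 1" for k
  proof -
    have "even k \<or> \<not> (k mod 5 = 1 \<or> k mod 5 = 4)" using that by presburger
    thus ?thesis using chi4_even[of k] by (auto simp: rr1_def)
  qed
  ultimately show ?thesis
    using theta_triple_product[of x 6 10 1 "-1" "\<lambda>k. chi4 k * rr1 k" "x ^ 1200"] assms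
    by (simp add: alt_def)
qed

lemma theta_wY:
  assumes "norm x < 1" "x \<noteq> 0"
  shows "theta wY 80 x =
    2 * x ^ 80 * (qpoch_inf (x ^ 1200) (x ^ 1440) * qpoch_inf (x ^ 240) (x ^ 1440) * qpoch_inf (x ^ 1440) (x ^ 1440))"
proof -
  have "chi3 (3 * n + 1) = 1" for n unfolding chi3_def by presburger
  moreover have "chi3 k = 0" if "\<not> 3 dvd k - 1" "\<not> 3 dvd k + 1" for k
    using that by (intro chi3_eq_0) presburger
  ultimately show ?thesis
    using theta_triple_product[of x 80 3 1 "-1" wY "x ^ 1440"] assms
    by (simp add: alt_def)
qed

text \<open>For q = x^240 this is 2 x^90 psi(q^3).\<close>

lemma theta_wP:
  assumes "norm x < 1" "x \<noteq> 0"
  shows "theta wP 90 x =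
    2 * x ^ 90 * (qpoch_inf (- (x ^ 2160)) (x ^ 2880) * qpoch_inf (- (x ^ 720)) (x ^ 2880) * qpoch_inf (x ^ 2880) (x ^ 2880))"
proof -
  have "chi4 (4 * n + 1) = 1" for n unfolding chi4_def by presburger
  moreover have "chi4 k = 0" if "\<not> 4 dvd k - 1" "\<not> 4 dvd k + 1" for k
    using that by (intro chi4_even) presburger
  ultimately show ?thesis
    using theta_triple_product[of x 90 4 1 1 wP "x ^ 2880"] assms
    by (simp add: alt_def)
qed

text \<open>Euler's pentagonal number series in q^16, where q = x^240; the three products combine to
  (q^16; q^16).\<close>

lemma theta_pentagonal:
  assumes "norm x < 1" "x \<noteq> 0"
  shows "theta (\<lambda>w. chi3 w * chi4 w) 160 x =
    2 * x ^ 160 * (qpoch_inf (x ^ 7680) (x ^ 11520) * qpoch_inf (x ^ 3840) (x ^ 11520) * qpoch_inf (x ^ 11520) (x ^ 11520))"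
proof -
  have "chi3 (6 * n + 1) = 1" for n unfolding chi3_def by presburger
  moreover have "chi4 (6 * n + 1) = alt n" for n
    using chi4_add_double[of 1 "3 * n"] by (simp add: chi4_def alt_def add.commute)
  moreover have "chi3 k * chi4 k = 0" if "\<not> 6 dvd k - 1" "\<not> 6 dvd k + 1" for k
  proof -
    have "even k \<or> 3 dvd k" using that by presburger
    thus ?thesis using chi4_even[of k] chi3_eq_0[of k] by auto
  qed
  ultimately show ?thesis
    using theta_triple_product[of x 160 6 1 "-1" "\<lambda>w. chi3 w * chi4 w" "x ^ 11520"] assms
    by (simp add: alt_def)
qed

lemma theta_sgn1:
  assumes "norm x < 1" "x \<noteq> 0"
  shows "theta sgn1 15 x =
    2 * x ^ 15 * (qpoch_inf (x ^ 1200) (x ^ 1920) * qpoch_inf (x ^ 720) (x ^ 1920) * qpoch_inf (x ^ 1920) (x ^ 1920))"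
proof -
  have "sgn1 (8 * n + 1) = (if even n then 1 else -1)" for n
  proof (cases "even n")
    case True
    then obtain b where "n = 2 * b" by (rule evenE)
    thus ?thesis using sgn1_add_16[of 1 b] by (simp add: sgn1_def)
  next
    case False
    then obtain b where "n = 2 * b + 1" by (rule oddE)
    thus ?thesis using sgn1_add_16[of 9 b] by (simp add: sgn1_def)
  qed
  moreover have "sgn1 k = 0" if "\<not> 8 dvd k - 1" "\<not> 8 dvd k + 1" for k
  proof -
    have "\<not> (k mod 8 = 1 \<or> k mod 8 = 7)" using that by presburger
    \<comment> \<open>\<open>sgn1_sgn3_mod_8\<close> treats both weights jointly, so a point of the
      support of \<open>sgn3\<close> is supplied.\<close>
    moreover have "sgn3 3 \<noteq> 0" by (simp add: sgn3_def)
    ultimately show ?thesis using sgn1_sgn3_mod_8(1)[of k 3] by blast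
  qed
  ultimately show ?thesis
    using theta_triple_product[of x 15 8 1 "-1" sgn1 "x ^ 1920"] assms sgn1_uminus by simp
qed

lemma theta_sgn3:
  assumes "norm x < 1" "x \<noteq> 0"
  shows "theta sgn3 30 x =
    2 * x ^ 270 * (qpoch_inf (x ^ 3360) (x ^ 3840) * qpoch_inf (x ^ 480) (x ^ 3840) * qpoch_inf (x ^ 3840) (x ^ 3840))"
proof -
  have "sgn3 (8 * n + 3) = (if even n then 1 else -1)" for n
  proof (cases "even n")
    case True
    then obtain b where "n = 2 * b" by (rule evenE)
    thus ?thesis using sgn3_add_16[of 3 b] by (simp add: sgn3_def)
  next
    case False
    then obtain b where "n = 2 * b + 1" by (rule oddE)
    thus ?thesis using sgn3_add_16[of 11 b] by (simp add: sgn3_def)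
  qed
  moreover have "sgn3 k = 0" if "\<not> 8 dvd k - 3" "\<not> 8 dvd k + 3" for k
  proof -
    have "\<not> (k mod 8 = 3 \<or> k mod 8 = 5)" using that by presburger
    moreover have "sgn1 1 \<noteq> 0" by (simp add: sgn1_def)
    ultimately show ?thesis using sgn1_sgn3_mod_8(2)[of 1 k] by blast
  qed
  ultimately show ?thesis
    using theta_triple_product[of x 30 8 3 "-1" sgn3 "x ^ 3840"] assms sgn3_uminus by simp
qed

text \<open>This is phi(-q) for q = x^240.\<close>

lemma theta_alt:
  assumes "norm x < 1" "x \<noteq> 0"
  shows "theta alt 240 x = qpoch_inf (x ^ 240) (x ^ 480) * qpoch_inf (x ^ 240) (x ^ 480) * qpoch_inf (x ^ 480) (x ^ 480)"
proof -
  have "alt = (\<lambda>n. if even n then 1 else -1)" by (simp add: alt_def fun_eq_iff)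
  thus ?thesis using theta_alternating[OF assms, of 240] by simp
qed

section \<open>Factoring phi(-q) psi(q^3)\<close>

lemma prod_lessThan_2: "(\<Prod>r<2. f r) = f 0 * f (1::nat)"
  by (simp add: numeral_2_eq_2)

lemma prod_lessThan_3: "(\<Prod>r<3. f r) = f 0 * f (1::nat) * f 2"
  by (simp add: numeral_3_eq_3 numeral_2_eq_2)

lemma prod_lessThan_5: "(\<Prod>r<5. f r) = f 0 * f (1::nat) * f 2 * f 3 * f 4"
  by (simp add: eval_nat_numeral)

text \<open>One copy of (q; q^2) joins (q^2; q^2) to form (q; q). The other splits modulo 6, and its
  factor (q^3; q^6) combines with (-q^3; q^6) from psi(q^3) to (q^6; q^12).\<close>

lemma phi_psi_product:
  assumes "norm q < 1"
  shows "qpoch_inf q (q ^ 2) * qpoch_inf q (q ^ 2) * qpoch_inf (q ^ 2) (q ^ 2) *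
      (qpoch_inf (- (q ^ 9)) (q ^ 12) * qpoch_inf (- (q ^ 3)) (q ^ 12) * qpoch_inf (q ^ 12) (q ^ 12))
    = qpoch_inf q q * (qpoch_inf (q ^ 5) (q ^ 6) * qpoch_inf q (q ^ 6) * qpoch_inf (q ^ 6) (q ^ 6))"
proof -
  have nq: "norm (q ^ n) < 1" if "n > 0" for n
    using assms that by (simp add: norm_power power_less_one_iff)
  have p: "q * q = q ^ 2" "q * q ^ 2 = q ^ 3" "q * q ^ 4 = q ^ 5" "q ^ 6 * q ^ 6 = q ^ 12" "q ^ 3 * q ^ 6 = q ^ 9"
    by (simp_all add: eval_nat_numeral)
  have pp: "(q ^ 2) ^ 2 = q ^ 4" "(q ^ 2) ^ 3 = q ^ 6" "(q ^ 6) ^ 2 = q ^ 12" "(q ^ 3) ^ 2 = q ^ 6"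
    by (simp_all flip: power_mult)
  have pos: "(2::nat) > 0" "(3::nat) > 0" "(6::nat) > 0" by auto
  note p' = power_0 power_one_right mult_1_right mult_minus_left p
  have 1: "qpoch_inf q q = qpoch_inf q (q ^ 2) * qpoch_inf (q ^ 2) (q ^ 2)"
    using qpoch_inf_split[OF assms pos(1), of q] unfolding prod_lessThan_2 by (simp only: p')
  have 2: "qpoch_inf q (q ^ 2) = qpoch_inf q (q ^ 6) * qpoch_inf (q ^ 3) (q ^ 6) * qpoch_inf (q ^ 5) (q ^ 6)"
    using qpoch_inf_split[OF nq[OF pos(1)] pos(2), of q] unfolding prod_lessThan_3 pp by (simp only: p')
  have 3: "qpoch_inf (- (q ^ 3)) (q ^ 6) = qpoch_inf (- (q ^ 3)) (q ^ 12) * qpoch_inf (- (q ^ 9)) (q ^ 12)"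
    using qpoch_inf_split[OF nq[OF pos(3)] pos(1), of "- (q ^ 3)"] unfolding prod_lessThan_2 pp by (simp only: p')
  have 4: "qpoch_inf (q ^ 3) (q ^ 6) * qpoch_inf (- (q ^ 3)) (q ^ 6) = qpoch_inf (q ^ 6) (q ^ 12)"
    using qpoch_inf_mult_uminus[OF nq[OF pos(3)], of "q ^ 3"] unfolding pp by simp
  have 5: "qpoch_inf (q ^ 6) (q ^ 6) = qpoch_inf (q ^ 6) (q ^ 12) * qpoch_inf (q ^ 12) (q ^ 12)"
    using qpoch_inf_split[OF nq[OF pos(3)] pos(1), of "q ^ 6"] unfolding prod_lessThan_2 pp by (simp only: p')
  show ?thesis
    unfolding 1 5 4[symmetric] 3 by (subst (2) 2) (simp only: mult_ac)
qed

subsection \<open>Enumerating the square indices\<close>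

text \<open>The solutions of j^2 = 121 modulo 240 below 120. The modulus 120 suffices because (120a
  + j)^2 and j^2 agree modulo 240.\<close>

definition root_residues :: "nat list" where
  "root_residues = [11, 19, 29, 59, 61, 91, 101, 109]"

definition sq_root :: "nat \<Rightarrow> nat" where
  "sq_root n = 120 * (n div 8) + root_residues ! (n mod 8)"

lemma less_8_cases:
  fixes i :: nat
  assumes "i < 8"
  obtains "i = 0" | "i = 1" | "i = 2" | "i = 3" | "i = 4" | "i = 5" | "i = 6" | "i = 7"
  using assms by linarith

lemma strict_mono_sq_root: "strict_mono sq_root"
proof (rule strict_mono_Suc_iff[THEN iffD2], intro allI)
  fix n :: nat
  have "n mod 8 < 8" by simp
  then consider "n mod 8 = 7" | "n mod 8 < 7" by linarith
  thus "sq_root n < sq_root (Suc n)"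
  proof cases
    case 1
    hence "Suc n mod 8 = 0" "Suc n div 8 = Suc (n div 8)"
      by (auto simp: mod_Suc div_Suc)
    thus ?thesis using 1 by (simp add: sq_root_def root_residues_def)
  next
    case 2
    hence "Suc n mod 8 = Suc (n mod 8)" "Suc n div 8 = n div 8"
      by (auto simp: mod_Suc div_Suc)
    moreover from 2 have "root_residues ! (n mod 8) < root_residues ! Suc (n mod 8)"
      using \<open>n mod 8 < 8\<close> by (elim less_8_cases) (simp_all add: root_residues_def)
    ultimately show ?thesis by (simp add: sq_root_def)
  qed
qed

lemma sq_root_in_range:
  assumes "k mod 120 \<in> set root_residues"
  shows "k \<in> range sq_root"
proof -
  have "length root_residues = 8" by (simp add: root_residues_def)
  with assms obtain i where i: "i < 8" "root_residues ! i = k mod 120"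
    by (metis in_set_conv_nth)
  hence "sq_root (8 * (k div 120) + i) = k"
    by (simp add: sq_root_def)
  thus ?thesis by (metis rangeI)
qed

lemma sq_root_mod: "sq_root n mod 120 \<in> set root_residues"
proof -
  have "n mod 8 < 8" by simp
  hence "root_residues ! (n mod 8) \<in> set root_residues"
    by (intro nth_mem) (simp add: root_residues_def)
  moreover have "\<forall>j\<in>set root_residues. j mod 120 = j"
    by (simp add: root_residues_def)
  ultimately show ?thesis by (simp add: sq_root_def)
qed

lemma square_mod_240: "(k::nat)\<^sup>2 mod 240 = (k mod 120)\<^sup>2 mod 240"
proof -
  have "k = 120 * (k div 120) + k mod 120" by simp
  then obtain a j where k: "k = 120 * a + j" "j = k mod 120" by blast
  have "k\<^sup>2 = j\<^sup>2 + 240 * (60 * a\<^sup>2 + a * j)"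
    unfolding k(1) by (simp add: power2_eq_square algebra_simps)
  hence "k\<^sup>2 mod 240 = j\<^sup>2 mod 240" by (simp only: mod_mult_self2)
  thus ?thesis using k(2) by simp
qed

lemma root_residues_iff: "k mod 120 \<in> set root_residues \<longleftrightarrow> k\<^sup>2 mod 240 = 121"
proof -
  define j where "j = k mod 120"
  have "\<forall>j\<in>set [0..119::int]. j \<in> set (map int root_residues) \<longleftrightarrow> j * j mod 240 = 121"
    by code_simp
  moreover have "int j \<in> set [0..119]"
    using mod_less_divisor[of 120 k] by (simp add: j_def)
  ultimately have "int j \<in> int ` set root_residues \<longleftrightarrow> int j * int j mod 240 = 121"
    by simp
  moreover have "int j * int j mod 240 = int (j\<^sup>2 mod 240)"
    by (simp add: of_nat_mod power2_eq_square)
  ultimately show ?thesis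
    unfolding square_mod_240[of k] j_def[symmetric] by (simp add: inj_image_mem_iff)
qed

text \<open>By strong induction: if f n = g a, then a < n would give f a = f n, so g n <= g a = f n;
  the other inequality is symmetric.\<close>

lemma strict_mono_range_unique:
  fixes f g :: "nat \<Rightarrow> nat"
  assumes "strict_mono f" "strict_mono g" "range f = range g"
  shows "f = g"
proof
  fix n
  show "f n = g n"
  proof (induction n rule: less_induct)
    case (less n)
    obtain a b where ab: "f n = g a" "g n = f b"
      using assms(3) by (metis rangeE rangeI)
    have "a \<ge> n" "b \<ge> n"
      using less ab assms(1,2) by (metis not_le strict_mono_eq less_irrefl)+
    hence "g n \<le> g a" "f n \<le> f b"
      using assms(1,2) by (auto simp: strict_mono_less_eq)
    thus ?case using ab by simp
  qed
qed

text \<open>The index belonging to \<open>sq_root n\<close> increases strictly with \<open>n\<close>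
  and runs through all of \<open>sq_index_set\<close>, so it is the enumeration.\<close>

lemma sq_index_sq_root: "240 * sq_index n + 121 = (sq_root n)\<^sup>2"
proof -
  define f where "f n = ((sq_root n)\<^sup>2 - 121) div 240" for n
  have f: "240 * f n + 121 = (sq_root n)\<^sup>2" for n
  proof -
    have "(sq_root n)\<^sup>2 mod 240 = 121"
      using root_residues_iff sq_root_mod by blast
    hence *: "(sq_root n)\<^sup>2 = 240 * ((sq_root n)\<^sup>2 div 240) + 121"
      using mult_div_mod_eq[of 240 "(sq_root n)\<^sup>2"] by simp
    hence "(sq_root n)\<^sup>2 - 121 = 240 * ((sq_root n)\<^sup>2 div 240)" by linarith
    hence "f n = (sq_root n)\<^sup>2 div 240" unfolding f_def by simp
    thus ?thesis using * by simp
  qed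
  have "strict_mono f"
  proof (rule strict_monoI)
    fix m n :: nat assume "m < n"
    hence "(sq_root m)\<^sup>2 < (sq_root n)\<^sup>2"
      using strict_mono_sq_root by (simp add: power_strict_mono strict_mono_less)
    thus "f m < f n" using f[of m] f[of n] by linarith
  qed
  moreover have "strict_mono (enumerate sq_index_set)"
    using infinite_sq_index_set by (simp add: strict_mono_def enumerate_mono)
  moreover have "range f = sq_index_set"
  proof (intro equalityI subsetI)
    fix m assume "m \<in> range f"
    thus "m \<in> sq_index_set" using f unfolding sq_index_set_def by blast
  next
    fix m assume "m \<in> sq_index_set"
    then obtain k where k: "240 * m + 121 = k\<^sup>2" unfolding sq_index_set_def by blast
    have "k\<^sup>2 mod 240 = 121" unfolding k[symmetric] by simp
    then obtain n where "k = sq_root n"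
      using sq_root_in_range root_residues_iff by blast
    hence "m = f n" using f[of n] k by simp
    thus "m \<in> range f" by simp
  qed
  ultimately have "enumerate sq_index_set = f"
    using infinite_sq_index_set by (intro strict_mono_range_unique) (auto simp: range_enumerate)
  thus ?thesis using f[of n] by (simp add: sq_index_def)
qed

text \<open>Advancing \<open>n\<close> by 8 adds 120 to the root, a common period of the weights,
  and 2 to the exponent of -1; eight values remain to be checked.\<close>

lemma sq_root_weight:
  "wT (int (sq_root n)) * rr1 (int (sq_root n)) = (- 1) ^ ((n + 2) div 4)"
proof -
  define j i where "j = n div 8" and "i = n mod 8"
  have n: "n = 8 * j + i" "i < 8" by (simp_all add: j_def i_def)
  have K: "int (sq_root n) = int (root_residues ! i) + 120 * int j"
    by (simp add: sq_root_def i_def j_def)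
  have "chi3 (k + 120 * l) = chi3 k" "oct3 (k + 120 * l) = oct3 k" "rr1 (k + 120 * l) = rr1 k" for k l
    using chi3_add_3[of k "40 * l"] oct3_add_8[of k "15 * l"] mod_mult_self1[of k "24 * l" 5]
    by (simp_all add: rr1_def mult.commute)
  moreover have "(n + 2) div 4 = 2 * j + (i + 2) div 4"
    unfolding n(1) by simp
  moreover from n(2) have "wT (int (root_residues ! i)) * rr1 (int (root_residues ! i)) = (- 1) ^ ((i + 2) div 4)"
    by (elim less_8_cases) (simp_all add: root_residues_def chi3_def oct3_def rr1_def)
  ultimately show ?thesis
    unfolding K by (simp add: power_add)
qed

text \<open>The support consists of eight classes modulo 120, two for each of the moduli 3, 8 and 5,
  and these are the root residues.\<close>

lemma weight_support:
  assumes "wT k * rr1 k \<noteq> 0" "k \<ge> 0"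
  shows "k \<in> range (\<lambda>n. int (sq_root n))"
proof -
  have int_mod: "int m mod numeral a = int (m mod numeral a)" for m a
    by (simp add: of_nat_mod)
  obtain m where m: "k = int m" using assms(2) nonneg_int_cases by blast
  from assms(1) have "k mod 3 \<noteq> 0" "k mod 8 = 3 \<or> k mod 8 = 5" "k mod 5 = 1 \<or> k mod 5 = 4"
    unfolding chi3_def oct3_def rr1_def by (auto split: if_splits)
  hence "m mod 3 \<noteq> 0" "m mod 8 = 3 \<or> m mod 8 = 5" "m mod 5 = 1 \<or> m mod 5 = 4"
    unfolding m int_mod by auto
  hence "m mod 120 mod 3 \<noteq> 0" "m mod 120 mod 8 = 3 \<or> m mod 120 mod 8 = 5" "m mod 120 mod 5 = 1 \<or> m mod 120 mod 5 = 4"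
    by (simp_all add: mod_mod_cancel)
  moreover have "\<forall>j\<in>set [0..<120]. j mod 3 \<noteq> 0 \<longrightarrow> j mod 8 = 3 \<or> j mod 8 = 5 \<longrightarrow> j mod 5 = 1 \<or> j mod 5 = 4
      \<longrightarrow> j \<in> set root_residues"
    by code_simp
  moreover have "m mod 120 \<in> set [0..<120]" by simp
  ultimately have "m mod 120 \<in> set root_residues" by blast
  thus ?thesis using sq_root_in_range m by blast
qed

text \<open>The weight is even and lives on the roots and their negatives, none of which is 0, so
  \<open>theta\<close> is twice the sum over roots. Dividing by x^121 turns x^(240m + 121) into
  q^m.\<close>

lemma has_sum_sq_index:
  assumes "norm x < 1" "x \<noteq> 0"
  shows "((\<lambda>n. (- 1) ^ ((n + 2) div 4) * (x ^ 240) ^ sq_index n) has_sum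
    (theta (\<lambda>k. wT k * rr1 k) 1 x / (2 * x ^ 121))) UNIV"
proof -
  let ?c = "\<lambda>k. wT k * rr1 k"
  let ?f = "\<lambda>k. of_int (?c k) * x ^ nat (1 * k\<^sup>2)"
  let ?A = "range (\<lambda>n. int (sq_root n))"
  let ?B = "uminus ` ?A"
  have even: "?c (- k) = ?c k" for k
  proof -
    have "rr1 (- k) = - rr1 k" "oct3 (- k) = oct3 k" unfolding rr1_def oct3_def by presburger+
    thus ?thesis by simp
  qed
  have "(\<lambda>k. ?f k) abs_summable_on ?A"
    by (rule theta_summable) (use assms in \<open>auto intro!: abs_mult_le_1 simp del: mult_minus_left\<close>)
  hence "?f summable_on ?A"
    by (rule abs_summable_summable)
  then obtain S where A: "(?f has_sum S) ?A"
    using has_sum_infsum by blast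
  have inj: "inj (\<lambda>n. int (sq_root n))"
    using strict_mono_imp_inj_on[OF strict_mono_sq_root] by (auto simp: inj_def)
  have "sq_root n > 0" for n
    using sq_index_sq_root[of n] by (metis add_eq_0_iff_both_eq_0 gr0I power_zero_numeral zero_neq_numeral)
  hence "?A \<inter> ?B = {}"
    by (auto simp: image_iff) (metis add_eq_0_iff less_irrefl of_nat_0_less_iff add_pos_pos)
  moreover have "(?f has_sum S) ?B"
  proof -
    have "((?f \<circ> uminus) has_sum S) ?A \<longleftrightarrow> (?f has_sum S) ?B"
      by (rule has_sum_reindex[symmetric]) (auto simp: inj_on_def)
    moreover have "?f \<circ> uminus = ?f" unfolding o_def even by simp
    ultimately show ?thesis using A by simp
  qed
  ultimately have "(?f has_sum (S + S)) (?A \<union> ?B)"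
    using A has_sum_Un_disjoint by blast
  moreover have "(?f has_sum (S + S)) (?A \<union> ?B) \<longleftrightarrow> (?f has_sum (S + S)) UNIV"
  proof (rule has_sum_cong_neutral)
    fix k assume k: "k \<in> UNIV - (?A \<union> ?B)"
    have "?c k = 0"
    proof (cases "k \<ge> 0")
      case True
      thus ?thesis using weight_support[of k] k by blast
    next
      case False
      hence "- k \<in> ?A" if "?c k \<noteq> 0"
        using that by (intro weight_support) (simp_all only: even, simp)
      hence "k \<in> ?B" if "?c k \<noteq> 0"
        using that by (metis image_eqI minus_minus)
      thus ?thesis using k by blast
    qed
    thus "?f k = 0" by simp
  qed auto
  ultimately have "(?f has_sum (S + S)) UNIV" by simp
  hence th: "theta ?c 1 x = S + S"
    unfolding theta_def by (rule infsumI)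
  have "((?f \<circ> (\<lambda>n. int (sq_root n))) has_sum S) UNIV"
    using A inj by (simp only: has_sum_reindex)
  moreover have "(?f \<circ> (\<lambda>n. int (sq_root n))) n = x ^ 121 * ((- 1) ^ ((n + 2) div 4) * (x ^ 240) ^ sq_index n)" for n
  proof -
    have "nat (1 * (int (sq_root n))\<^sup>2) = 240 * sq_index n + 121"
      unfolding sq_index_sq_root by (simp add: nat_power_eq)
    hence "x ^ nat (1 * (int (sq_root n))\<^sup>2) = (x ^ 240) ^ sq_index n * x ^ 121"
      by (simp only: power_add power_mult)
    thus ?thesis
      unfolding o_def sq_root_weight by simp
  qed
  ultimately have "((\<lambda>n. x ^ 121 * ((- 1) ^ ((n + 2) div 4) * (x ^ 240) ^ sq_index n)) has_sum S) UNIV"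
    by (metis (no_types, lifting) has_sum_cong)
  from has_sum_cmult_right[OF this, of "1 / x ^ 121"] show ?thesis
    using assms(2) unfolding th by (simp add: mult.assoc[symmetric])
qed

subsection \<open>The identity\<close>

lemma qpoch_root_identity:
  assumes "norm x < 1" "x \<noteq> 0" and q: "q = x ^ 240"
  shows "theta (\<lambda>k. wT k * rr1 k) 1 x / (2 * x ^ 121) =
    qpochs_inf [q ^ 3, q ^ 5, q ^ 8] (q ^ 8) * qpochs_inf [q ^ 2, q ^ 14] (q ^ 16)
      / qpochs_inf [q, q ^ 4] (q ^ 5)"
proof -
  have nq: "norm (q ^ n) < 1" if "n > 0" for n
    using assms(1) that unfolding q power_mult[symmetric] norm_power by (simp add: power_less_one_iff)
  have nq1: "norm q < 1" using nq[of 1] by simp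
  have nz: "qpoch_inf (q ^ a) (q ^ n) \<noteq> 0" if "n > 0" "a > 0" for a n
    using that by (intro qpoch_inf_nonzero nq)
  have nz1: "qpoch_inf q (q ^ n) \<noteq> 0" if "n > 0" for n
    using nz[OF that, of 1] by simp
  have xq: "x ^ 480 = q ^ 2" "x ^ 720 = q ^ 3" "x ^ 1200 = q ^ 5" "x ^ 1440 = q ^ 6" "x ^ 1920 = q ^ 8"
    "x ^ 2160 = q ^ 9" "x ^ 2880 = q ^ 12" "x ^ 3360 = q ^ 14" "x ^ 3840 = q ^ 16" "x ^ 7680 = q ^ 32" "x ^ 11520 = q ^ 48"
    "x ^ 240 = q"
    unfolding q by (simp_all flip: power_mult)
  define T1 T2 where "T1 = theta (\<lambda>k. wT k * rr1 k) 1 x" and "T2 = theta (\<lambda>k. wT k * rr2 k) 1 x"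
  define d1 d2 where "d1 = theta (\<lambda>k. chi4 k * rr1 k) 6 x" and "d2 = theta (\<lambda>k. chi4 k * rr2 k) 6 x"
  define X1 X2 where "X1 = theta (\<lambda>k. chi4 k * rr1 k) 36 x" and "X2 = theta (\<lambda>k. chi4 k * rr2 k) 36 x"
  define N Y where "N = theta wN 5 x" and "Y = theta wY 80 x"
  define \<Phi> \<Psi> where "\<Phi> = theta alt 240 x" and "\<Psi> = theta wP 90 x"

  have "T1 * d2 = T2 * d1" "T1 * X2 - T2 * X1 = - (N * Y)" "d1 * X2 - d2 * X1 = - 2 * (\<Phi> * \<Psi>)"
    unfolding T1_def T2_def d1_def d2_def X1_def X2_def N_def Y_def \<Phi>_def \<Psi>_def
    by (intro rr_proportional gaussian_rotation phi_psi_rotation assms)+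
  \<comment> \<open>Multiplying the second relation by \<open>d1\<close> and replacing
    \<open>T2 * d1\<close> by \<open>T1 * d2\<close> gives \<open>T1\<close> times the left side of
    the third.\<close>
  hence main: "2 * T1 * (\<Phi> * \<Psi>) = N * Y * d1"
    by algebra

  define D where "D = qpoch_inf (q ^ 3) (q ^ 5) * qpoch_inf (q ^ 2) (q ^ 5) * qpoch_inf (q ^ 5) (q ^ 5)"
  define y where "y = qpoch_inf (q ^ 5) (q ^ 6) * qpoch_inf q (q ^ 6) * qpoch_inf (q ^ 6) (q ^ 6)"
  define f where "f = qpoch_inf q q"
  define M where "M = qpoch_inf (q ^ 5) (q ^ 8) * qpoch_inf (q ^ 3) (q ^ 8) * qpoch_inf (q ^ 8) (q ^ 8)"
  define L where "L = qpoch_inf (q ^ 14) (q ^ 16) * qpoch_inf (q ^ 2) (q ^ 16)"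
  define E where "E = qpoch_inf (q ^ 16) (q ^ 16)"
  define R where "R = qpoch_inf q (q ^ 5) * qpoch_inf (q ^ 4) (q ^ 5)"
  have d1: "d1 = 2 * x ^ 6 * D"
    unfolding d1_def D_def theta_rogers_ramanujan[OF assms(1,2)] xq ..
  have Y: "Y = 2 * x ^ 80 * y"
    unfolding Y_def y_def theta_wY[OF assms(1,2)] xq ..
  have PP: "\<Phi> * \<Psi> = 2 * x ^ 90 * (f * y)"
    unfolding \<Phi>_def \<Psi>_def f_def y_def phi_psi_product[OF nq1, symmetric] theta_alt[OF assms(1,2)] theta_wP[OF assms(1,2)] xq
    by simp
  have pos: "(3::nat) > 0" "(5::nat) > 0" "(16::nat) > 0" by auto
  have pp: "(q ^ 16) ^ 3 = q ^ 48" "q ^ 16 * (q ^ 16) ^ 2 = q ^ 48" "q ^ 16 * q ^ 16 = q ^ 32"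
    by (simp_all flip: power_mult power_add)
  have E: "E = qpoch_inf (q ^ 16) (q ^ 48) * qpoch_inf (q ^ 32) (q ^ 48) * qpoch_inf (q ^ 48) (q ^ 48)"
    unfolding E_def qpoch_inf_split[OF nq[OF pos(3)] pos(1), of "q ^ 16"] prod_lessThan_3 pp
    by (simp only: power_0 power_one_right mult_1_right pp)
  \<comment> \<open>The pentagonal product equals \<open>E\<close>, which is also a factor of the
    series of \<open>sgn3\<close>; cancelling it leaves \<open>N\<close>.\<close>
  have "N * (2 * x ^ 160 * E) = (2 * x ^ 15 * M) * (2 * x ^ 270 * (L * E))"
    using quintuple_rotation[OF assms(1)]
    unfolding N_def theta_pentagonal[OF assms(1,2)] theta_sgn1[OF assms(1,2)] theta_sgn3[OF assms(1,2)] xq M_def L_def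
      E_def[symmetric] unfolding E by (simp only: mult_ac)
  also have "\<dots> = (2 * x ^ 125 * (M * L)) * (2 * x ^ 160 * E)"
    by (simp flip: power_add add: mult_ac)
  finally have N: "N = 2 * x ^ 125 * (M * L)"
    using assms(2) nz[of 16 16] by (simp add: E_def)
  have f: "f = R * D"
    unfolding f_def qpoch_inf_split[OF nq1 pos(2), of q] prod_lessThan_5 R_def D_def
    by (simp flip: power_Suc power2_eq_square add: mult_ac)
  have "R \<noteq> 0" "D \<noteq> 0" "y \<noteq> 0"
    unfolding R_def D_def y_def by (simp_all add: nz nz1)
  \<comment> \<open>The powers of x balance: 125 + 80 + 6 = 90 + 121.\<close>
  have "(8 * x ^ 90) * (T1 * (R * D * y)) = (8 * x ^ 90) * (2 * x ^ 121 * (M * L) * (D * y))"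
  proof -
    have "(8 * x ^ 90) * (T1 * (R * D * y)) = 2 * (2 * T1 * (\<Phi> * \<Psi>))"
      unfolding PP f by simp
    also have "\<dots> = (8 * x ^ 90) * (2 * x ^ 121 * (M * L) * (D * y))"
      unfolding main d1 Y N by (simp flip: power_add add: mult_ac)
    finally show ?thesis .
  qed
  moreover have "8 * x ^ 90 \<noteq> 0" using assms(2) by simp
  ultimately have "T1 * (R * D * y) = 2 * x ^ 121 * (M * L) * (D * y)"
    using mult_left_cancel by blast
  hence "T1 * R = 2 * x ^ 121 * (M * L)"
    using \<open>D \<noteq> 0\<close> \<open>y \<noteq> 0\<close> by (simp add: mult_ac)
  hence "T1 / (2 * x ^ 121) = M * L / R"
    using assms(2) \<open>R \<noteq> 0\<close> by (simp add: field_simps)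
  thus ?thesis
    unfolding T1_def M_def L_def R_def by (simp add: qpochs_inf_def mult_ac)
qed

theorem theorem9:
  fixes q :: complex
  assumes "norm q < 1"
  shows "(\<lambda>n. (- 1) ^ nat \<lfloor>(real n + 2) / 4\<rfloor> * q ^ sq_index n) sums
    (qpochs_inf [q ^ 3, q ^ 5, q ^ 8] (q ^ 8) * qpochs_inf [q ^ 2, q ^ 14] (q ^ 16)
      / qpochs_inf [q, q ^ 4] (q ^ 5))"
proof -
  have sign: "nat \<lfloor>(real n + 2) / 4\<rfloor> = (n + 2) div 4" for n
    using floor_divide_of_nat_eq[where ?'a = real, of "n + 2" 4] by (simp add: add.commute)
  show ?thesis
  proof (cases "q = 0")
    \<comment> \<open>For q = 0 no nonzero root x exists. Only a_0 = 0 contributes, through 0^0 = 1,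
      and every product equals 1.\<close>
    case True
    have "sq_index n = 0 \<longleftrightarrow> n = 0" for n
    proof -
      have "sq_index 0 = 0"
        using sq_index_sq_root[of 0] by (simp add: sq_root_def root_residues_def)
      moreover have "sq_index 0 < sq_index n" if "n > 0"
        unfolding sq_index_def using that infinite_sq_index_set by (rule enumerate_mono)
      ultimately show ?thesis by (cases "n = 0") auto
    qed
    hence "(\<lambda>n. (- 1) ^ nat \<lfloor>(real n + 2) / 4\<rfloor> * q ^ sq_index n) = (\<lambda>n. if n = 0 then 1 else 0)"
      unfolding sign True by (auto simp: fun_eq_iff power_0_left)
    moreover have "qpoch_inf 0 0 = 1"
      by (simp add: qpoch_inf_def)
    ultimately show ?thesis
      using sums_single[of 0 "\<lambda>_. 1 :: complex"] True by (simp add: qpochs_inf_def)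
  next
    case False
    \<comment> \<open>Some 240th root of q; its norm is below 1 because that of q is.\<close>
    define x where "x = exp (Ln q / 240)"
    have x: "q = x ^ 240"
      using False by (simp add: x_def flip: exp_of_nat_mult)
    have "x \<noteq> 0" by (simp add: x_def)
    have "norm x < 1"
    proof (rule ccontr)
      assume "\<not> norm x < 1"
      hence "norm x ^ 240 \<ge> 1" by (intro one_le_power) simp
      thus False using assms by (simp add: x norm_power)
    qed
    show ?thesis
      using has_sum_imp_sums[OF has_sum_sq_index[OF \<open>norm x < 1\<close> \<open>x \<noteq> 0\<close>]]
      unfolding sign qpoch_root_identity[OF \<open>norm x < 1\<close> \<open>x \<noteq> 0\<close> x] x[symmetric] .
  qed
qed

end
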